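(* Let $q$ be a prime power and $n\ge 2$. Let $R=\mathbb{F}_q[x_1,\dots,x_n]/I$ be an $(n-1,m)$-Hom-Furstenberg algebra, and suppose $J_l(R)\ne\langle0\rangle$ for some integer $l\le m$. Then $$\dim_{\mathbb{F}_q}R\ge qm\Big(1-\frac{l-1}{m}\Big).$$
   Context: For an ideal $I\subseteq\mathbb{F}[x_1,\dots,x_n]$, $R=\mathbb{F}[x_1,\dots,x_n]/I$ with $N=\dim_{\mathbb{F}}R<\infty$. $R$ (with $I$ homogeneous) is $(k,m)$-Hom-Furstenberg if for every $k$-dimensional linear subspace $V\subseteq\mathbb{F}^n$, $\dim_{\mathbb{F}}\mathbb{F}[x]/(I+\mathbf{I}(V))\ge m$, where $\mathbf{I}(V)$ is the ideal of polynomials vanishing on $V$. Definition of $J_l(R)$: fix an $\mathbb{F}$-basis of $R$ and let $U(h)$ be the $N\times N$ matrix over $\mathbb{F}[h_1,\dots,h_n]$ representing multiplication by $h_1x_1+\dots+h_nx_n$ on $R$. $J_l(R)$ is the ideal of $\mathbb{F}[h_1,\dots,h_n]$ generated by all $(N-l+1)\times(N-l+1)$ minors of $U(h)$ (independent of the basis); by convention it is $\langle 0\rangle$ if $N-l+1>N$ and the unit ideal if $N-l+1\le0$. *)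

theory Defs
  imports
    "HOL-Analysis.Cartesian_Space"
    "HOL-Library.Poly_Mapping"
    "HOL-Algebra.Algebraic_Closure_Type"
    "HOL-Algebra.Embedded_Algebras"
    "HOL-Algebra.QuotRing"
    "Jordan_Normal_Form.Determinant"
    "Jordan_Normal_Form.DL_Submatrix"
begin

hide_const (open) Matrix.mat Matrix.vec
no_notation vec_index (infixl \<open>$\<close> 100)

text \<open>
  Polynomials in the variables indexed by the finite type \<open>'n\<close>: finitely supported coefficient
  functions on exponent vectors.
\<close>

type_synonym ('n, 'a) mpoly = "('n \<Rightarrow>\<^sub>0 nat) \<Rightarrow>\<^sub>0 'a"

abbreviation poly_ring :: "('n, 'a::comm_ring_1) mpoly ring" where
  "poly_ring \<equiv> ring_of_type_algebra"

definition mconst :: "'a::comm_ring_1 \<Rightarrow> ('n, 'a) mpoly" where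
  "mconst c = Poly_Mapping.single 0 c"

definition mvar :: "'n \<Rightarrow> ('n, 'a::comm_ring_1) mpoly" where
  "mvar i = Poly_Mapping.single (Poly_Mapping.single i 1) 1"

definition homogeneous :: "nat \<Rightarrow> ('n::finite, 'a::comm_ring_1) mpoly \<Rightarrow> bool" where
  "homogeneous d f \<longleftrightarrow> (\<forall>e \<in> Poly_Mapping.keys f. (\<Sum>i\<in>UNIV. Poly_Mapping.lookup e i) = d)"

definition homogeneous_ideal :: "('n::finite, 'a::comm_ring_1) mpoly set \<Rightarrow> bool" where
  "homogeneous_ideal I \<longleftrightarrow> (\<exists>S. (\<forall>f\<in>S. \<exists>d. homogeneous d f) \<and> I = Idl\<^bsub>poly_ring\<^esub> S)"

text \<open>The algebra \<open>R = F[x]/J\<close>, the image of \<open>F\<close> in it, and its dimension over \<open>F\<close>.\<close>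

abbreviation quot_alg :: "('n, 'a::comm_ring_1) mpoly set \<Rightarrow> ('n, 'a) mpoly set ring" where
  "quot_alg J \<equiv> poly_ring Quot J"

definition quot_const :: "('n, 'a::comm_ring_1) mpoly set \<Rightarrow> 'a \<Rightarrow> ('n, 'a) mpoly set" where
  "quot_const J c = J +>\<^bsub>poly_ring\<^esub> mconst c"

definition quot_finite_dim :: "('n, 'a::field) mpoly set \<Rightarrow> bool" where
  "quot_finite_dim J \<longleftrightarrow>
     ring.finite_dimension (quot_alg J) (range (quot_const J)) (carrier (quot_alg J))"

definition quot_dim :: "('n, 'a::field) mpoly set \<Rightarrow> nat" where
  "quot_dim J = ring.dim (quot_alg J) (range (quot_const J)) (carrier (quot_alg J))"

definition quot_basis :: "('n, 'a::field) mpoly set \<Rightarrow> ('n, 'a) mpoly set list \<Rightarrow> bool" where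
  "quot_basis J bs \<longleftrightarrow>
     ring.independent (quot_alg J) (range (quot_const J)) bs \<and>
     ring.Span (quot_alg J) (range (quot_const J)) bs = carrier (quot_alg J)"

definition quot_coords ::
    "('n, 'a::field) mpoly set \<Rightarrow> ('n, 'a) mpoly set list \<Rightarrow> ('n, 'a) mpoly set \<Rightarrow> 'a list" where
  "quot_coords J bs v =
     (THE cs. length cs = length bs \<and> ring.combine (quot_alg J) (map (quot_const J) cs) bs = v)"

text \<open>
  The ideal of a linear subspace \<open>V\<close> of \<open>F\<^sup>n\<close> is taken in the sense of algebraic geometry: \<open>V\<close> is
  regarded as a linear subvariety of affine space, so that a polynomial vanishes on \<open>V\<close> if it
  vanishes at all points of \<open>V\<close> over the algebraic closure. Equivalently, the ideal is generated
  by the linear forms vanishing on \<open>V\<close>. The finitely many \<open>F\<close>-rational points would not do for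
  finite \<open>F\<close>: every \<open>x\<^sub>i\<^sup>q - x\<^sub>i\<close> vanishes at them, and then \<open>F[x]/(I + I(V))\<close> would have
  dimension at most 1 for every homogeneous \<open>I\<close> of finite codimension.
\<close>

definition ac_eval :: "('n::finite, 'a::field) mpoly \<Rightarrow> 'a alg_closure ^ 'n \<Rightarrow> 'a alg_closure" where
  "ac_eval f v = (\<Sum>e \<in> Poly_Mapping.keys f.
     to_ac (Poly_Mapping.lookup f e) * (\<Prod>i\<in>UNIV. (v $ i) ^ Poly_Mapping.lookup e i))"

definition ac_points :: "('a::field ^ 'n::finite) set \<Rightarrow> ('a alg_closure ^ 'n) set" where
  "ac_points V = vec.span ((\<lambda>v. \<chi> i. to_ac (v $ i)) ` V)"

definition vanishing_ideal :: "('a::field ^ 'n::finite) set \<Rightarrow> ('n, 'a) mpoly set" where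
  "vanishing_ideal V = {f. \<forall>v \<in> ac_points V. ac_eval f v = 0}"

definition hom_furstenberg :: "('n::finite, 'a::field) mpoly set \<Rightarrow> nat \<Rightarrow> nat \<Rightarrow> bool" where
  "hom_furstenberg I k m \<longleftrightarrow>
     ideal I poly_ring \<and> homogeneous_ideal I \<and> quot_finite_dim I \<and>
     (\<forall>V :: ('a ^ 'n) set. vec.subspace V \<and> vec.dim V = k \<longrightarrow>
        quot_dim (I <+>\<^bsub>poly_ring\<^esub> vanishing_ideal V) \<ge> m)"

text \<open>
  \<open>mult_matrix I bs\<close> is the matrix \<open>U(h)\<close>: its \<open>k\<close>-th column is the coordinate vector of
  \<open>(\<Sum>j. h\<^sub>j x\<^sub>j) b\<^sub>k\<close>, with the indeterminates \<open>h\<^sub>j\<close> indexed by the same type as the \<open>x\<^sub>j\<close>.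
\<close>

definition mult_matrix ::
    "('n::finite, 'a::field) mpoly set \<Rightarrow> ('n, 'a) mpoly set list \<Rightarrow> ('n, 'a) mpoly Matrix.mat" where
  "mult_matrix I bs = Matrix.mat (length bs) (length bs) (\<lambda>(i, k).
     \<Sum>j\<in>UNIV. mconst (quot_coords I bs
       ((I +>\<^bsub>poly_ring\<^esub> mvar j) \<otimes>\<^bsub>quot_alg I\<^esub> (bs ! k)) ! i) * mvar j)"

definition minors :: "'b::comm_ring_1 Matrix.mat \<Rightarrow> nat \<Rightarrow> 'b set" where
  "minors A r = {Determinant.det (submatrix A S T) | S T.
     S \<subseteq> {..<dim_row A} \<and> T \<subseteq> {..<dim_col A} \<and> card S = r \<and> card T = r}"

definition J_ideal ::
    "('n::finite, 'a::field) mpoly set \<Rightarrow> ('n, 'a) mpoly set list \<Rightarrow> int \<Rightarrow> ('n, 'a) mpoly set" where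
  "J_ideal I bs l =
     (let N = int (length bs); r = N - l + 1 in
      if r > N then {0} else if r \<le> 0 then UNIV
      else Idl\<^bsub>poly_ring\<^esub> (minors (mult_matrix I bs) (nat r)))"

end

theory Submission
  imports Defs
begin

text \<open>
  Let \<open>N = dim R\<close> and \<open>r = N - l + 1\<close>, and let \<open>P\<close> be a nonzero \<open>r \<times> r\<close> minor of \<open>U(h)\<close>; its degree
  is at most \<open>r\<close>. For \<open>a \<noteq> 0\<close> in \<open>F\<^sub>q\<^sup>n\<close>, the linear form \<open>a\<^sub>1 x\<^sub>1 + \<dots> + a\<^sub>n x\<^sub>n\<close> vanishes on a hyperplane, so
  the Furstenberg property bounds the rank of \<open>U(a)\<close> by \<open>N - m\<close>; hence \<open>P\<close> vanishes at \<open>a\<close> to order at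
  least \<open>r - (N - m) = m - l + 1\<close>. This also holds at \<open>a = 0\<close>. By the Schwartz-Zippel lemma with
  multiplicities, a nonzero polynomial vanishing to order \<open>s\<close> at all points of \<open>F\<^sub>q\<^sup>n\<close> has degree at
  least \<open>q s\<close>, so \<open>q (m - l + 1) \<le> r \<le> N\<close>. Ranks over \<open>F\<^sub>q\<close> are measured by cardinalities of images.
\<close>

section \<open>Hasse derivatives over a finite field\<close>

lemma pcompose_power: "pcompose (p ^ k) q = pcompose p q ^ k"
  for p q :: "'a::comm_ring_1 poly"
  by (induction k) (simp_all add: pcompose_mult pcompose_1)

text \<open>Binomial expansion of \<open>c * (X + a) ^ n\<close>. For \<open>j > n\<close> the
  natural-number subtraction in the exponent is harmless, because the binomial coefficient
  vanishes.\<close>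

lemma coeff_pcompose_linear_monom:
  "coeff (pcompose (monom c n) [:a, 1:]) j = c * (of_nat (n choose j) * a ^ (n - j))"
  for c a :: "'a::comm_ring_1"
proof (cases "j \<le> n")
  case False
  have "degree ([:a, 1:] ^ n) \<le> n" using degree_power_le[of "[:a, 1:]" n] by simp
  with False show ?thesis
    by (simp add: monom_altdef pcompose_smult pcompose_power pcompose_pCons coeff_eq_0 binomial_eq_0)
qed (simp add: monom_altdef pcompose_smult pcompose_power pcompose_pCons coeff_linear_poly_power)

text \<open>Let \<open>j\<close> be the least order of vanishing of \<open>g\<close> over all field
  elements. Every \<open>(X - b) ^ j\<close> divides \<open>g\<close>, which forces
  \<open>q * j \<le> degree g\<close>; at a point where the minimum is attained, the
  \<open>j\<close>-th Taylor coefficient is nonzero.\<close>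

lemma exists_low_order_point:
  fixes g :: "'a::{field,finite} poly"
  assumes "g \<noteq> 0"
  shows "\<exists>a j. CARD('a) * j \<le> degree g \<and> coeff (pcompose g [:a, 1:]) j \<noteq> 0"
proof -
  define j where "j = Min (range (\<lambda>a. order a g))"
  have fin: "finite (range (\<lambda>a. order a g))" by simp
  have le: "j \<le> order a g" for a
    unfolding j_def by (rule Min_le[OF fin]) auto
  obtain a where a: "order a g = j"
    using Min_in[OF fin] unfolding j_def by (metis UNIV_not_empty imageE image_is_empty)
  \<comment> \<open>The polynomial is generalised for the induction: dividing by
    \<open>[:-b, 1:] ^ j\<close> leaves the orders at all other points unchanged.\<close>
  have "card A * j \<le> degree f"
    if "finite A" "f \<noteq> 0" "\<forall>b\<in>A. j \<le> order b f" for A and f :: "'a poly"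
    using that
  proof (induction A arbitrary: f)
    case (insert b A)
    then have "[:-b, 1:] ^ j dvd f"
      by (meson dvd_trans insertI1 le_imp_power_dvd order_1)
    then obtain h where h: "f = [:-b, 1:] ^ j * h" by (elim dvdE)
    with insert.prems have [simp]: "h \<noteq> 0" by auto
    have "order c h = order c f" if "c \<in> A" for c
    proof -
      have "b \<noteq> c" using that insert.hyps by auto
      then have "order c ([:-b, 1:] ^ j) = 0" by (intro order_0I) simp
      then show ?thesis using insert.prems by (simp add: h order_mult)
    qed
    then have "card A * j \<le> degree h" using insert by auto
    moreover have "degree f = j + degree h"
      using insert.prems by (simp add: h degree_mult_eq degree_power_eq)
    ultimately show ?case using insert.hyps by simp
  qed auto
  from this[of UNIV g] assms le have deg: "CARD('a) * j \<le> degree g" by simp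
  obtain h where h: "g = [:-a, 1:] ^ j * h" and "\<not> [:-a, 1:] dvd h"
    using order_decomp[OF assms, of a] a by auto
  then have nz: "poly h a \<noteq> 0" by (simp add: poly_eq_0_iff_dvd)
  \<comment> \<open>Translation by \<open>a\<close> turns the factor \<open>(X - a) ^ j\<close> into
    \<open>X ^ j\<close>, so the coefficient at \<open>j\<close> is the constant term of the
    translated cofactor, namely \<open>poly h a\<close>.\<close>
  have "pcompose g [:a, 1:] = monom 1 j * pcompose h [:a, 1:]"
    by (simp add: h pcompose_mult pcompose_power pcompose_pCons monom_altdef)
  then have "coeff (pcompose g [:a, 1:]) j = poly h a"
    by (simp add: coeff_monom_mult)
  with nz deg show ?thesis by metis
qed

text \<open>
  The sum below is the \<open>e\<close>-th Hasse derivative at \<open>a\<close> of the polynomial with coefficients \<open>c\<close>.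
  The leading coefficient with respect to one variable \<open>x\<close> has, inductively, a nonvanishing
  derivative of low order at some point of the remaining coordinates; taking the same derivative of
  the whole polynomial leaves a univariate polynomial in \<open>x\<close> whose degree is still the degree in \<open>x\<close>.
\<close>

lemma exists_nonzero_hasse_derivative:
  fixes c :: "('n \<Rightarrow> nat) \<Rightarrow> 'a::{field,finite}"
  assumes "finite A" "finite B" "\<forall>b\<in>B. \<forall>i. i \<notin> A \<longrightarrow> b i = 0"
    "\<exists>b\<in>B. c b \<noteq> 0" "\<forall>b\<in>B. (\<Sum>i\<in>A. b i) \<le> d"
  shows "\<exists>e a. (\<forall>i. i \<notin> A \<longrightarrow> e i = 0) \<and> CARD('a) * (\<Sum>i\<in>A. e i) \<le> d \<and>
    (\<Sum>b\<in>B. c b * (\<Prod>i\<in>A. of_nat (b i choose e i) * a i ^ (b i - e i))) \<noteq> 0"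
  using assms
proof (induction A arbitrary: B c d rule: finite_induct)
  case empty
  then have "b = (\<lambda>_. 0)" if "b \<in> B" for b using that by auto
  with empty have B: "B = {\<lambda>_. 0}" "c (\<lambda>_. 0) \<noteq> 0" by auto
  then show ?case by (intro exI[of _ "\<lambda>_. 0"]) simp
next
  case (insert x A)
  define N where "N = {b\<in>B. c b \<noteq> 0}"
  \<comment> \<open>Only exponents with nonzero coefficient count, so \<open>t\<close> is the true
    degree in \<open>x\<close> although \<open>B\<close> may contain further exponents.\<close>
  define t where "t = Max ((\<lambda>b. b x) ` N)"
  have N: "finite N" "N \<noteq> {}" using insert.prems unfolding N_def by auto
  have le_t: "b x \<le> t" if "b \<in> N" for b
    unfolding t_def using that N by (intro Max_ge) auto
  obtain b0 where b0: "b0 \<in> N" "b0 x = t"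
  proof -
    have "t \<in> (\<lambda>b. b x) ` N" unfolding t_def using N by (intro Max_in) auto
    then show thesis using that by blast
  qed
  define Bt where "Bt = {b\<in>B. b x = t}"
  \<comment> \<open>\<open>B'\<close> and \<open>c'\<close> encode the leading coefficient with
    respect to \<open>x\<close>: the \<open>x\<close>-exponent is erased from the top slice, and
    \<open>c'\<close> restores it as \<open>t\<close>. Nothing collides, since it equals
    \<open>t\<close> throughout the slice.\<close>
  define B' where "B' = (\<lambda>b. b(x := 0)) ` Bt"
  define c' where "c' b = c (b(x := t))" for b
  have inj: "inj_on (\<lambda>b. b(x := 0)) Bt"
  proof (rule inj_onI)
    fix b b' assume *: "b \<in> Bt" "b' \<in> Bt" "b(x := 0) = b'(x := 0)"
    have "b i = b' i" for i
      using *(1,2) fun_cong[OF *(3), of i] by (cases "i = x") (auto simp: Bt_def split: if_splits)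
    then show "b = b'" by auto
  qed
  have c': "c' (b(x := 0)) = c b" if "b \<in> Bt" for b
    using that by (auto simp: c'_def Bt_def fun_upd_idem)
  have sumA: "(\<Sum>i\<in>A. (b(x := k)) i) = (\<Sum>i\<in>A. b i)" for b :: "'n \<Rightarrow> nat" and k
    using insert.hyps by (intro sum.cong) auto
  have "\<exists>e a. (\<forall>i. i \<notin> A \<longrightarrow> e i = 0) \<and> CARD('a) * (\<Sum>i\<in>A. e i) \<le> d - t \<and>
    (\<Sum>b\<in>B'. c' b * (\<Prod>i\<in>A. of_nat (b i choose e i) * a i ^ (b i - e i))) \<noteq> 0"
  proof (rule insert.IH)
    show "finite B'" using insert.prems by (auto simp: B'_def Bt_def)
    show "\<forall>b\<in>B'. \<forall>i. i \<notin> A \<longrightarrow> b i = 0"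
      using insert.prems by (auto simp: B'_def Bt_def)
    show "\<exists>b\<in>B'. c' b \<noteq> 0"
      using b0 c' unfolding B'_def N_def Bt_def by force
    show "\<forall>b\<in>B'. (\<Sum>i\<in>A. b i) \<le> d - t"
    proof
      fix b assume "b \<in> B'"
      then obtain b' where b': "b' \<in> B" "b' x = t" "b = b'(x := 0)"
        by (auto simp: B'_def Bt_def)
      then have "t + (\<Sum>i\<in>A. b' i) \<le> d" using insert by auto
      then show "(\<Sum>i\<in>A. b i) \<le> d - t" using b' by (simp only: sumA)
    qed
  qed
  then obtain e a where e: "\<forall>i. i \<notin> A \<longrightarrow> e i = 0" "CARD('a) * (\<Sum>i\<in>A. e i) \<le> d - t"
    and nz: "(\<Sum>b\<in>B'. c' b * (\<Prod>i\<in>A. of_nat (b i choose e i) * a i ^ (b i - e i))) \<noteq> 0"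
    by blast
  define w where "w b = (\<Prod>i\<in>A. of_nat (b i choose e i) * a i ^ (b i - e i))" for b
  have w: "w (b(x := k)) = w b" for b k
    unfolding w_def using insert.hyps by (intro prod.cong) auto
  \<comment> \<open>The derivative \<open>e\<close> at \<open>a\<close> in the variables of
    \<open>A\<close>, with \<open>x\<close> left free; its coefficient at \<open>t\<close> is the
    nonzero value supplied by the induction hypothesis.\<close>
  define g where "g = (\<Sum>b\<in>B. monom (c b * w b) (b x))"
  have "coeff g t = (\<Sum>b\<in>B. if b x = t then c b * w b else 0)"
    by (simp add: g_def coeff_sum)
  also have "\<dots> = (\<Sum>b\<in>Bt. c b * w b)"
    unfolding Bt_def using insert.prems by (simp add: sum.If_cases Int_def)
  also have "\<dots> = (\<Sum>b\<in>B'. c' b * w b)"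
    unfolding B'_def by (subst sum.reindex[OF inj]) (auto simp: c' w intro!: sum.cong)
  finally have gt: "coeff g t \<noteq> 0" using nz by (simp add: w_def)
  have "degree g \<le> t"
    unfolding g_def
  proof (rule degree_sum_le)
    fix b assume "b \<in> B"
    then show "degree (monom (c b * w b) (b x)) \<le> t"
      using le_t[of b] degree_monom_le[of "c b * w b" "b x"]
      by (cases "c b = 0") (auto simp: N_def)
  qed (use insert.prems in auto)
  moreover have "g \<noteq> 0" using gt by auto
  ultimately obtain z j where j: "CARD('a) * j \<le> t" and cj: "coeff (pcompose g [:z, 1:]) j \<noteq> 0"
    using exists_low_order_point[of g] by (meson le_trans)
  have "coeff (pcompose g [:z, 1:]) j =
      (\<Sum>b\<in>B. c b * w b * (of_nat (b x choose j) * z ^ (b x - j)))"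
    by (simp add: g_def pcompose_sum coeff_sum coeff_pcompose_linear_monom mult_ac)
  also have "\<dots> = (\<Sum>b\<in>B. c b * (\<Prod>i\<in>insert x A. of_nat (b i choose (e(x := j)) i) *
      (a(x := z)) i ^ (b i - (e(x := j)) i)))"
  proof (intro sum.cong refl)
    fix b
    have "w b = (\<Prod>i\<in>A. of_nat (b i choose (e(x := j)) i) * (a(x := z)) i ^ (b i - (e(x := j)) i))"
      unfolding w_def using insert.hyps by (intro prod.cong) auto
    then show "c b * w b * (of_nat (b x choose j) * z ^ (b x - j)) =
      c b * (\<Prod>i\<in>insert x A. of_nat (b i choose (e(x := j)) i) *
      (a(x := z)) i ^ (b i - (e(x := j)) i))"
      using insert.hyps by (simp add: mult_ac)
  qed
  finally have fin: "(\<Sum>b\<in>B. c b * (\<Prod>i\<in>insert x A. of_nat (b i choose (e(x := j)) i) *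
      (a(x := z)) i ^ (b i - (e(x := j)) i))) \<noteq> 0" using cj by simp
  \<comment> \<open>The degree budget splits as \<open>d = (d - t) + t\<close>: the first part pays
    for \<open>e\<close>, the second for \<open>j\<close>. The inequality \<open>t \<le> d\<close>
    ensures that the subtraction does not truncate.\<close>
  have "t \<le> d" using b0 insert by (auto simp: N_def intro: add_leD1)
  moreover have "(\<Sum>i\<in>insert x A. (e(x := j)) i) = j + (\<Sum>i\<in>A. e i)"
    using insert.hyps sumA[of e j] by simp
  ultimately have "CARD('a) * (\<Sum>i\<in>insert x A. (e(x := j)) i) \<le> d"
    using e(2) j by (simp add: distrib_left)
  moreover have "\<forall>i. i \<notin> insert x A \<longrightarrow> (e(x := j)) i = 0" using e by auto
  ultimately show ?case using fin by blast
qed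

section \<open>Evaluation and translation of polynomials\<close>

text \<open>The coefficient map \<open>c\<close> allows the target to be another ring:
  \<open>mconst\<close> gives substitution of polynomials, \<open>to_ac\<close> gives evaluation
  over the algebraic closure.\<close>

definition mpoly_eval ::
    "('a::comm_ring_1 \<Rightarrow> 'b::comm_ring_1) \<Rightarrow> ('n::finite \<Rightarrow> 'b) \<Rightarrow> ('n, 'a) mpoly \<Rightarrow> 'b" where
  "mpoly_eval c v f = (\<Sum>e \<in> Poly_Mapping.keys f.
     c (Poly_Mapping.lookup f e) * (\<Prod>i\<in>UNIV. v i ^ Poly_Mapping.lookup e i))"

lemma mpoly_eq_sum_single:
  "f = (\<Sum>e\<in>Poly_Mapping.keys f. Poly_Mapping.single e (Poly_Mapping.lookup f e))"
  by (rule poly_mapping_eqI) (simp add: lookup_sum lookup_single when_def in_keys_iff)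

context comm_ring_hom
begin

lemma mpoly_eval_superset:
  assumes "finite S" "Poly_Mapping.keys f \<subseteq> S"
  shows "mpoly_eval hom v f =
    (\<Sum>e\<in>S. hom (Poly_Mapping.lookup f e) * (\<Prod>i\<in>UNIV. v i ^ Poly_Mapping.lookup e i))"
  unfolding mpoly_eval_def using assms
  by (intro sum.mono_neutral_left) (auto simp: in_keys_iff)

lemma mpoly_eval_single:
  "mpoly_eval hom v (Poly_Mapping.single e x) = hom x * (\<Prod>i\<in>UNIV. v i ^ Poly_Mapping.lookup e i)"
  by (subst mpoly_eval_superset[of "{e}"]) (auto simp: lookup_single)

lemma mpoly_eval_add: "mpoly_eval hom v (f + g) = mpoly_eval hom v f + mpoly_eval hom v g"
proof -
  let ?S = "Poly_Mapping.keys f \<union> Poly_Mapping.keys g"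
  have "Poly_Mapping.keys (f + g) \<subseteq> ?S" by (rule keys_add)
  then show ?thesis
    by (simp add: mpoly_eval_superset[of ?S] lookup_add hom_add distrib_right sum.distrib)
qed

lemma mpoly_eval_0: "mpoly_eval hom v 0 = 0"
  by (simp add: mpoly_eval_def)

lemma mpoly_eval_sum: "mpoly_eval hom v (\<Sum>x\<in>A. f x) = (\<Sum>x\<in>A. mpoly_eval hom v (f x))"
  by (induction A rule: infinite_finite_induct) (simp_all add: mpoly_eval_0 mpoly_eval_add)

lemma mpoly_eval_mult: "mpoly_eval hom v (f * g) = mpoly_eval hom v f * mpoly_eval hom v g"
proof -
  let ?s = "\<lambda>f e. Poly_Mapping.single e (Poly_Mapping.lookup f e)"
  let ?K = "Poly_Mapping.keys"
  have "f * g = (\<Sum>e\<in>?K f. ?s f e) * (\<Sum>e\<in>?K g. ?s g e)"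
    by (simp flip: mpoly_eq_sum_single)
  then have "mpoly_eval hom v (f * g) = (\<Sum>e\<in>?K f. \<Sum>e'\<in>?K g. mpoly_eval hom v (?s f e * ?s g e'))"
    by (simp add: sum_product mpoly_eval_sum)
  also have "\<dots> = (\<Sum>e\<in>?K f. \<Sum>e'\<in>?K g. mpoly_eval hom v (?s f e) * mpoly_eval hom v (?s g e'))"
    by (simp add: mult_single mpoly_eval_single hom_mult lookup_add power_add prod.distrib mult_ac)
  also have "\<dots> = mpoly_eval hom v (\<Sum>e\<in>?K f. ?s f e) * mpoly_eval hom v (\<Sum>e\<in>?K g. ?s g e)"
    by (simp add: sum_product mpoly_eval_sum)
  finally show ?thesis by (simp flip: mpoly_eq_sum_single)
qed

lemma mpoly_eval_1: "mpoly_eval hom v 1 = 1"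
  using mpoly_eval_single[of v 0 1] by simp

lemma comm_ring_hom_mpoly_eval: "comm_ring_hom (mpoly_eval hom v)"
  by unfold_locales (simp_all add: mpoly_eval_0 mpoly_eval_1 mpoly_eval_add mpoly_eval_mult)

lemma mpoly_eval_mconst: "mpoly_eval hom v (mconst x) = hom x"
  by (simp add: mconst_def mpoly_eval_single)

lemma mpoly_eval_mvar: "mpoly_eval hom v (mvar i) = v i"
proof -
  have "(\<Prod>j\<in>UNIV. v j ^ Poly_Mapping.lookup (Poly_Mapping.single i (1::nat)) j) =
      (\<Prod>j\<in>UNIV. if j = i then v j else 1)"
    by (intro prod.cong) (auto simp: lookup_single)
  then show ?thesis by (simp add: mvar_def mpoly_eval_single)
qed

end

section \<open>Constants, monomials and translations\<close>

lemma mconst_0 [simp]: "mconst 0 = 0"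
  and mconst_1 [simp]: "mconst 1 = 1"
  and mconst_add: "mconst (x + y) = mconst x + mconst y"
  and mconst_mult: "mconst (x * y) = mconst x * mconst y"
  by (simp_all add: mconst_def single_add mult_single)

interpretation mconst: comm_ring_hom mconst
  by unfold_locales (simp_all add: mconst_add mconst_mult)

lemma mvar_power: "mvar i ^ k = Poly_Mapping.single (Poly_Mapping.single i k) 1"
  by (induction k) (simp_all add: mvar_def mult_single flip: single_add)

lemma prod_single:
  "(\<Prod>i\<in>A. Poly_Mapping.single (f i) (x i)) = Poly_Mapping.single (\<Sum>i\<in>A. f i) (\<Prod>i\<in>A. x i)"
  for f :: "'b \<Rightarrow> 'c::comm_monoid_add" and x :: "'b \<Rightarrow> 'a::comm_ring_1"
  by (induction A rule: infinite_finite_induct) (simp_all add: mult_single)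

lemma lookup_sum_single:
  "Poly_Mapping.lookup (\<Sum>i\<in>UNIV. Poly_Mapping.single i (g i)) = g"
  for g :: "'n::finite \<Rightarrow> nat"
  by (rule ext) (simp add: lookup_sum lookup_single when_def)

text \<open>The polynomial \<open>f(x + a)\<close>. Being a ring homomorphism in \<open>f\<close>,
  translation commutes with determinants.\<close>

definition mshift :: "('n \<Rightarrow> 'a) \<Rightarrow> ('n::finite, 'a::comm_ring_1) mpoly \<Rightarrow> ('n, 'a) mpoly" where
  "mshift a = mpoly_eval mconst (\<lambda>i. mvar i + mconst (a i))"

interpretation mshift: comm_ring_hom "mshift a" for a
  unfolding mshift_def by (rule mconst.comm_ring_hom_mpoly_eval)

text \<open>The coefficients of a translate are the Hasse derivatives at \<open>a\<close>. Binomial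
  coefficients, rather than iterated derivatives divided by factorials, keep this valid in positive
  characteristic.\<close>

lemma lookup_mshift:
  "Poly_Mapping.lookup (mshift a f) e = (\<Sum>b\<in>Poly_Mapping.keys f. Poly_Mapping.lookup f b *
     (\<Prod>i\<in>UNIV. of_nat (Poly_Mapping.lookup b i choose Poly_Mapping.lookup e i) *
        a i ^ (Poly_Mapping.lookup b i - Poly_Mapping.lookup e i)))"
  for a :: "'n::finite \<Rightarrow> 'a::comm_ring_1"
proof -
  define t where "t n k x = of_nat (n choose k) * x ^ (n - k)" for n k and x :: 'a
  have pw: "(mvar i + mconst x) ^ n = (\<Sum>k\<le>n. Poly_Mapping.single (Poly_Mapping.single i k) (t n k x))"
    for i :: 'n and x :: 'a and n
  proof -
    have "of_nat (n choose k) * mvar i ^ k * mconst x ^ (n - k) =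
        Poly_Mapping.single (Poly_Mapping.single i k) (t n k x)" for k
      by (simp add: t_def mvar_power mconst_def mult_single flip: mconst.hom_power[unfolded mconst_def] single_of_nat)
    then show ?thesis by (simp add: binomial_ring)
  qed
  have "Poly_Mapping.lookup (\<Prod>i\<in>UNIV. (mvar i + mconst (a i)) ^ b i) e =
      (\<Prod>i\<in>UNIV. t (b i) (Poly_Mapping.lookup e i) (a i))" for b
  proof -
    \<comment> \<open>Expanding the product of sums means choosing one exponent \<open>g i\<close>
      per variable; exactly one choice can yield the monomial \<open>e\<close>.\<close>
    let ?P = "PiE UNIV (\<lambda>i. {..b i})"
    have fin: "finite ?P" by (rule finite_PiE) auto
    have "(\<Prod>i\<in>UNIV. (mvar i + mconst (a i)) ^ b i) =
      (\<Sum>g\<in>?P. Poly_Mapping.single (\<Sum>i\<in>UNIV. Poly_Mapping.single i (g i)) (\<Prod>i\<in>UNIV. t (b i) (g i) (a i)))"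
      by (simp add: pw prod_sum_PiE prod_single)
    moreover have "(\<Sum>i\<in>UNIV. Poly_Mapping.single i (g i)) = e \<longleftrightarrow> g = Poly_Mapping.lookup e"
      for g :: "'n \<Rightarrow> nat"
      by (metis lookup_sum_single poly_mapping_eqI)
    ultimately have "Poly_Mapping.lookup (\<Prod>i\<in>UNIV. (mvar i + mconst (a i)) ^ b i) e =
        (\<Sum>g\<in>?P. if g = Poly_Mapping.lookup e then \<Prod>i\<in>UNIV. t (b i) (g i) (a i) else 0)"
      by (simp add: lookup_sum lookup_single when_def)
    also have "\<dots> = (if Poly_Mapping.lookup e \<in> ?P then \<Prod>i\<in>UNIV. t (b i) (Poly_Mapping.lookup e i) (a i) else 0)"
      using fin by simp
    also have "\<dots> = (\<Prod>i\<in>UNIV. t (b i) (Poly_Mapping.lookup e i) (a i))"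
    proof (cases "Poly_Mapping.lookup e \<in> ?P")
      case False
      \<comment> \<open>If \<open>e\<close> exceeds \<open>b\<close> in some variable, no choice
        yields \<open>e\<close>; the closed formula agrees because that binomial coefficient is
        0.\<close>
      then obtain i where "b i < Poly_Mapping.lookup e i" by (auto simp: PiE_def Pi_def not_le)
      then have "t (b i) (Poly_Mapping.lookup e i) (a i) = 0" by (simp add: t_def binomial_eq_0)
      then have "(\<Prod>i\<in>UNIV. t (b i) (Poly_Mapping.lookup e i) (a i)) = 0"
        by (intro prod_zero) auto
      with False show ?thesis by simp
    qed simp
    finally show ?thesis .
  qed
  moreover have "Poly_Mapping.lookup (mconst x * g) e = x * Poly_Mapping.lookup g e" for x and g :: "('n, 'a) mpoly"
    by (simp add: mconst_def Poly_Mapping.map.rep_eq when_def flip: mult_map_scale_conv_mult)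
  ultimately show ?thesis
    by (simp add: mshift_def mpoly_eval_def lookup_sum t_def)
qed

section \<open>Order of vanishing at the origin and total degree\<close>

definition order_ge :: "nat \<Rightarrow> ('n::finite, 'a::comm_ring_1) mpoly \<Rightarrow> bool" where
  "order_ge k f \<longleftrightarrow> (\<forall>e\<in>Poly_Mapping.keys f. k \<le> (\<Sum>i\<in>UNIV. Poly_Mapping.lookup e i))"

lemma order_ge_mono: "order_ge k f \<Longrightarrow> j \<le> k \<Longrightarrow> order_ge j f"
  by (auto simp: order_ge_def intro: le_trans)

text \<open>The zero polynomial has every order, which is why the order is recorded as a lower bound
  and not as a number.\<close>

lemma order_ge_0 [simp]: "order_ge 0 f" "order_ge k 0"
  by (auto simp: order_ge_def)

lemma order_ge_add: "order_ge k f \<Longrightarrow> order_ge k g \<Longrightarrow> order_ge k (f + g)"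
  using keys_add[of f g] by (auto simp: order_ge_def)

lemma order_ge_sum: "(\<And>x. x \<in> A \<Longrightarrow> order_ge k (f x)) \<Longrightarrow> order_ge k (\<Sum>x\<in>A. f x)"
  by (induction A rule: infinite_finite_induct) (simp_all add: order_ge_add)

lemma order_ge_mult: "order_ge j f \<Longrightarrow> order_ge k g \<Longrightarrow> order_ge (j + k) (f * g)"
  using keys_mult[of f g] by (fastforce simp: order_ge_def lookup_add sum.distrib intro: add_mono)

lemma order_ge_mult_left: "order_ge k g \<Longrightarrow> order_ge k (f * g)"
  using order_ge_mult[of 0 f k g] by simp

lemma order_ge_prod: "(\<And>x. x \<in> A \<Longrightarrow> order_ge (k x) (f x)) \<Longrightarrow> order_ge (\<Sum>x\<in>A. k x) (\<Prod>x\<in>A. f x)"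
  by (induction A rule: infinite_finite_induct) (simp_all add: order_ge_mult)

lemma order_ge_mvar: "order_ge 1 (mvar i)"
  by (auto simp: order_ge_def mvar_def lookup_single when_def)

definition degree_le :: "nat \<Rightarrow> ('n::finite, 'a::comm_ring_1) mpoly \<Rightarrow> bool" where
  "degree_le k f \<longleftrightarrow> (\<forall>e\<in>Poly_Mapping.keys f. (\<Sum>i\<in>UNIV. Poly_Mapping.lookup e i) \<le> k)"

lemma degree_le_sum: "(\<And>x. x \<in> A \<Longrightarrow> degree_le k (f x)) \<Longrightarrow> degree_le k (\<Sum>x\<in>A. f x)"
  using keys_sum[of f A] by (fastforce simp: degree_le_def)

lemma degree_le_mult: "degree_le j f \<Longrightarrow> degree_le k g \<Longrightarrow> degree_le (j + k) (f * g)"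
  using keys_mult[of f g] by (fastforce simp: degree_le_def lookup_add sum.distrib intro: add_mono)

lemma degree_le_mconst: "degree_le 0 (mconst c)"
  by (auto simp: degree_le_def mconst_def)

lemma degree_le_mvar: "degree_le 1 (mvar i)"
  by (auto simp: degree_le_def mvar_def lookup_single when_def)

lemma degree_le_prod:
  "(\<And>x. x \<in> A \<Longrightarrow> degree_le (k x) (f x)) \<Longrightarrow> degree_le (\<Sum>x\<in>A. k x) (\<Prod>x\<in>A. f x)"
proof (induction A rule: infinite_finite_induct)
  case (insert x A)
  then show ?case by (simp add: degree_le_mult)
qed (use degree_le_mconst[of 1] in auto)

text \<open>The Schwartz-Zippel bound with multiplicities in terms of translates: the nonvanishing
  Hasse derivative of low order is a nonzero coefficient of \<open>mshift a f\<close>, and its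
  exponent caps the order there.\<close>

lemma exists_low_order_shift:
  fixes f :: "('n::finite, 'a::{field,finite}) mpoly"
  assumes "f \<noteq> 0" "degree_le d f"
  shows "\<exists>a. \<forall>k. order_ge k (mshift a f) \<longrightarrow> CARD('a) * k \<le> d"
proof -
  let ?l = Poly_Mapping.lookup
  \<comment> \<open>The derivative lemma speaks of plain functions as exponents;
    \<open>Abs_poly_mapping\<close> recovers the exponent vector from its lookup function.\<close>
  let ?c = "\<lambda>b. ?l f (Abs_poly_mapping b)"
  have inj: "inj_on ?l (Poly_Mapping.keys f)" by (rule inj_onI) (simp add: poly_mapping_eqI)
  have "\<exists>e a. (\<forall>i. i \<notin> (UNIV::'n set) \<longrightarrow> e i = 0) \<and> CARD('a) * (\<Sum>i\<in>UNIV. e i) \<le> d \<and>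
    (\<Sum>b\<in>?l ` Poly_Mapping.keys f.
       ?c b * (\<Prod>i\<in>UNIV. of_nat (b i choose e i) * a i ^ (b i - e i))) \<noteq> 0"
    using assms by (intro exists_nonzero_hasse_derivative)
      (auto simp: degree_le_def in_keys_iff simp flip: keys_eq_empty)
  then obtain e a where e: "CARD('a) * (\<Sum>i\<in>UNIV. e i) \<le> d"
    and nz: "(\<Sum>b\<in>?l ` Poly_Mapping.keys f.
       ?c b * (\<Prod>i\<in>UNIV. of_nat (b i choose e i) * a i ^ (b i - e i))) \<noteq> 0"
    by blast
  define e' where "e' = (\<Sum>i\<in>UNIV. Poly_Mapping.single i (e i))"
  have e': "?l e' = e" by (simp add: e'_def lookup_sum_single)
  have "?l (mshift a f) e' \<noteq> 0"
    using nz by (simp add: lookup_mshift e' sum.reindex[OF inj])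
  then have "k \<le> (\<Sum>i\<in>UNIV. e i)" if "order_ge k (mshift a f)" for k
    using that e' by (auto simp: order_ge_def in_keys_iff)
  then show ?thesis using e by (meson le_trans mult_le_mono2)
qed

section \<open>Determinants of perturbed singular matrices\<close>

lemma card_carrier_vec:
  "card (carrier_vec n :: 'a::finite Matrix.vec set) = CARD('a) ^ n"
  "finite (carrier_vec n :: 'a::finite Matrix.vec set)"
proof -
  let ?L = "{xs :: 'a list. set xs \<subseteq> UNIV \<and> length xs = n}"
  have "bij_betw vec_of_list ?L (carrier_vec n)"
  proof (rule bij_betw_byWitness[where f' = list_of_vec])
    show "vec_of_list ` ?L \<subseteq> carrier_vec n" by (auto intro: carrier_vecI)
  qed (auto simp: list_vec vec_list)
  from bij_betw_same_card[OF this] bij_betw_finite[OF this]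
  show "card (carrier_vec n :: 'a Matrix.vec set) = CARD('a) ^ n"
    "finite (carrier_vec n :: 'a Matrix.vec set)"
    using card_lists_length_eq[of "UNIV :: 'a set" n] finite_lists_length_eq[of "UNIV :: 'a set" n]
    by simp_all
qed

text \<open>Pivot columns of a row echelon form are distinct unit vectors, so \<open>k\<close> pivots give \<open>q ^ k\<close>
  distinct vectors in the image; all other rows vanish.\<close>

lemma row_reduce_small_image:
  fixes A :: "'a::{field,finite} Matrix.mat"
  assumes A: "A \<in> carrier_mat r r"
    and small: "card ((\<lambda>v. A *\<^sub>v v) ` carrier_vec r) \<le> CARD('a) ^ \<rho>"
  obtains P Q Z where "P \<in> carrier_mat r r" "Q \<in> carrier_mat r r" "Q * P = 1\<^sub>m r"
    "Z \<subseteq> {..<r}" "card Z \<le> \<rho>"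
    "\<And>i j. i < r \<Longrightarrow> i \<notin> Z \<Longrightarrow> j < r \<Longrightarrow> (P * A) $$ (i, j) = 0"
proof -
  define C where "C = gauss_jordan_single A"
  note gj = gauss_jordan_single[OF A C_def[symmetric]]
  obtain P Q where PQ: "C = P * A" "P \<in> carrier_mat r r" "Q \<in> carrier_mat r r" "Q * P = 1\<^sub>m r"
    using gj(4) by auto
  have C: "C \<in> carrier_mat r r" by (rule gj(2))
  obtain f where f: "pivot_fun C f r"
    using gj(3) C unfolding row_echelon_form_def by auto
  have dC: "dim_row C = r" "dim_col C = r" using C by auto
  define Z where "Z = {i. i < r \<and> f i < r}"
  have finZ: "finite Z" by (simp add: Z_def)
  have unit: "C $$ (i', f i) = (if i' = i then 1 else 0)" if "i \<in> Z" "i' < r" for i i'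
    using that pivot_funD(4,5)[OF dC(1) f] unfolding Z_def by auto
  have zero_row: "C $$ (i, j) = 0" if "i < r" "i \<notin> Z" "j < r" for i j
    using that pivot_funD(1,2)[OF dC(1) f, of i] unfolding Z_def by auto
  have finV: "finite (carrier_vec r :: 'a Matrix.vec set)"
    by (rule card_carrier_vec)
  have "PiE Z (\<lambda>_. UNIV) \<subseteq> (\<lambda>w. restrict (vec_index w) Z) ` (\<lambda>v. P *\<^sub>v v) ` (\<lambda>v. A *\<^sub>v v) ` carrier_vec r"
  proof
    fix g :: "nat \<Rightarrow> 'a" assume g: "g \<in> PiE Z (\<lambda>_. UNIV)"
    \<comment> \<open>The value \<open>g i\<close> is placed in the pivot column \<open>f i\<close>.
      Defining \<open>v\<close> by a sum over \<open>Z\<close> makes a separate proof that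
      \<open>f\<close> is injective on \<open>Z\<close> unnecessary: after swapping the sums, the
      unit columns pick out \<open>g i'\<close>.\<close>
    define v where "v = Matrix.vec r (\<lambda>j. \<Sum>i\<in>Z. if f i = j then g i else 0)"
    have v: "v \<in> carrier_vec r" by (simp add: v_def)
    have "vec_index (C *\<^sub>v v) i' = g i'" if i': "i' \<in> Z" for i'
    proof -
      have "i' < r" using i' by (simp add: Z_def)
      then have "vec_index (C *\<^sub>v v) i' = (\<Sum>j<r. C $$ (i', j) * (\<Sum>i\<in>Z. if f i = j then g i else 0))"
        using dC by (simp add: scalar_prod_def v_def atLeast0LessThan)
      also have "\<dots> = (\<Sum>j<r. \<Sum>i\<in>Z. if f i = j then C $$ (i', j) * g i else 0)"
        by (simp add: sum_distrib_left if_distrib cong: if_cong)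
      also have "\<dots> = (\<Sum>i\<in>Z. \<Sum>j<r. if f i = j then C $$ (i', j) * g i else 0)"
        by (rule sum.swap)
      also have "\<dots> = (\<Sum>i\<in>Z. if i' = i then g i else 0)"
        using unit \<open>i' < r\<close> by (intro sum.cong) (auto simp: Z_def)
      also have "\<dots> = g i'" using i' finZ by simp
      finally show ?thesis .
    qed
    then have "g = restrict (vec_index (C *\<^sub>v v)) Z"
      using g by (intro ext) (auto simp: restrict_def PiE_def extensional_def)
    moreover have "C *\<^sub>v v = P *\<^sub>v (A *\<^sub>v v)" using PQ A v by simp
    ultimately show "g \<in> (\<lambda>w. restrict (vec_index w) Z) ` (\<lambda>v. P *\<^sub>v v) ` (\<lambda>v. A *\<^sub>v v) ` carrier_vec r"
      using v by auto
  qed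
  then have "card (PiE Z (\<lambda>_. UNIV :: 'a set)) \<le>
      card ((\<lambda>w. restrict (vec_index w) Z) ` (\<lambda>v. P *\<^sub>v v) ` (\<lambda>v. A *\<^sub>v v) ` carrier_vec r)"
    using finV by (intro card_mono) auto
  also have "\<dots> \<le> card ((\<lambda>v. P *\<^sub>v v) ` (\<lambda>v. A *\<^sub>v v) ` carrier_vec r)"
    using finV by (intro card_image_le) auto
  also have "\<dots> \<le> card ((\<lambda>v. A *\<^sub>v v) ` carrier_vec r)"
    using finV by (intro card_image_le) auto
  finally have "CARD('a) ^ card Z \<le> CARD('a) ^ \<rho>"
    using small finZ by (simp add: card_PiE)
  moreover have "CARD('a) > 1"
    using card_mono[of UNIV "{0, 1 :: 'a}"] by simp
  ultimately have "card Z \<le> \<rho>" by simp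
  then show thesis
    using that[of P Q Z] PQ zero_row by (auto simp: Z_def)
qed

text \<open>Each term of the Leibniz expansion takes one entry from every row, and at least
  \<open>r - \<rho>\<close> rows lie outside \<open>Z\<close>, each contributing order 1.\<close>

lemma order_ge_det:
  assumes E: "E \<in> carrier_mat r r" and Z: "Z \<subseteq> {..<r}" "card Z \<le> \<rho>"
    and row: "\<And>i j. i < r \<Longrightarrow> i \<notin> Z \<Longrightarrow> j < r \<Longrightarrow> order_ge 1 (E $$ (i, j))"
  shows "order_ge (r - \<rho>) (Determinant.det E)"
  unfolding det_def'[OF E]
proof (intro order_ge_sum order_ge_mult_left)
  fix p assume "p \<in> {p. p permutes {0..<r}}"
  then have p: "p i < r" if "i < r" for i using that by (auto dest: permutes_in_image[of p _ i])
  have "order_ge (\<Sum>i = 0..<r. if i \<in> Z then 0 else 1) (\<Prod>i = 0..<r. E $$ (i, p i))"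
    by (rule order_ge_prod) (auto intro: row[unfolded One_nat_def] simp: p)
  moreover have "(\<Sum>i = 0..<r. if i \<in> Z then 0 else 1) = r - card Z"
  proof -
    have "(\<Sum>i = 0..<r. if i \<in> Z then 0 else 1 :: nat) = card ({0..<r} - Z)"
      by (simp add: sum.If_cases Diff_eq)
    also have "\<dots> = r - card Z"
      using Z by (subst card_Diff_subset) (auto intro: finite_subset)
    finally show ?thesis .
  qed
  ultimately show "order_ge (r - \<rho>) (\<Prod>i = 0..<r. E $$ (i, p i))"
    using Z(2) by (auto elim: order_ge_mono)
qed

text \<open>Multiplying by the invertible \<open>P\<close> clears the constant part in all rows
  outside \<open>Z\<close>, while the remaining part still has order at least 1; so
  \<open>order_ge_det\<close> applies. Undoing this multiplies by the determinant of
  \<open>Q\<close>, which cannot lower the order.\<close>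

lemma order_ge_det_add_const:
  fixes A :: "'a::{field,finite} Matrix.mat" and B :: "('n::finite, 'a) mpoly Matrix.mat"
  assumes A: "A \<in> carrier_mat r r" and B: "B \<in> carrier_mat r r"
    and small: "card ((\<lambda>v. A *\<^sub>v v) ` carrier_vec r) \<le> CARD('a) ^ \<rho>"
    and ord: "\<And>i j. i < r \<Longrightarrow> j < r \<Longrightarrow> order_ge 1 (B $$ (i, j))"
  shows "order_ge (r - \<rho>) (Determinant.det (map_mat mconst A + B))"
proof -
  obtain P Q Z where P: "P \<in> carrier_mat r r" and Q: "Q \<in> carrier_mat r r" and QP: "Q * P = 1\<^sub>m r"
    and Z: "Z \<subseteq> {..<r}" "card Z \<le> \<rho>"
    and zero: "\<And>i j. i < r \<Longrightarrow> i \<notin> Z \<Longrightarrow> j < r \<Longrightarrow> (P * A) $$ (i, j) = 0"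
    using row_reduce_small_image[OF A small] by metis
  let ?m = "map_mat mconst :: 'a Matrix.mat \<Rightarrow> ('n, 'a) mpoly Matrix.mat"
  have carr: "?m A \<in> carrier_mat r r" "?m P \<in> carrier_mat r r" "?m Q \<in> carrier_mat r r"
    using A P Q by auto
  define E where "E = ?m P * (?m A + B)"
  have E: "E \<in> carrier_mat r r" using carr B by (simp add: E_def)
  have E': "E = ?m (P * A) + ?m P * B"
    unfolding E_def using carr B P A by (simp add: mult_add_distrib_mat mconst.mat_hom_mult)
  have "order_ge (r - \<rho>) (Determinant.det E)"
  proof (rule order_ge_det[OF E Z])
    fix i j assume ij: "i < r" "i \<notin> Z" "j < r"
    then have "E $$ (i, j) = (\<Sum>k = 0..<r. ?m P $$ (i, k) * B $$ (k, j))"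
      using zero[OF ij] carr B P A unfolding E' by (simp add: scalar_prod_def)
    then show "order_ge 1 (E $$ (i, j))"
      using ij by (auto intro!: order_ge_sum order_ge_mult_left ord[unfolded One_nat_def])
  qed
  moreover have "?m A + B = ?m Q * E"
  proof -
    have "?m Q * E = (?m Q * ?m P) * (?m A + B)"
      unfolding E_def using carr B by (intro assoc_mult_mat[symmetric]) auto
    also have "?m Q * ?m P = 1\<^sub>m r"
      using QP P Q by (metis mconst.mat_hom_mult mconst.mat_hom_one)
    finally show ?thesis using carr B by simp
  qed
  then have "Determinant.det (?m A + B) = Determinant.det (?m Q) * Determinant.det E"
    using det_mult carr E by metis
  ultimately show ?thesis by (simp add: order_ge_mult_left)
qed

lemma degree_le_det:
  fixes E :: "('n::finite, 'a::comm_ring_1) mpoly Matrix.mat"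
  assumes E: "E \<in> carrier_mat r r"
    and entry: "\<And>i j. i < r \<Longrightarrow> j < r \<Longrightarrow> degree_le 1 (E $$ (i, j))"
  shows "degree_le r (Determinant.det E)"
  unfolding det_def'[OF E]
proof (intro degree_le_sum)
  fix p assume "p \<in> {p. p permutes {0..<r}}"
  then have p: "p i < r" if "i < r" for i using that by (auto dest: permutes_in_image[of p _ i])
  have "degree_le (\<Sum>i = 0..<r. 1) (\<Prod>i = 0..<r. E $$ (i, p i))"
    by (rule degree_le_prod) (auto intro: entry[unfolded One_nat_def] simp: p)
  \<comment> \<open>Written as a constant, the sign has degree 0 and adds nothing to the
    bound.\<close>
  moreover have "(signof p :: ('n, 'a) mpoly) = mconst (signof p)"
    by (simp add: sign_def mconst.hom_uminus)
  ultimately show "degree_le r (signof p * (\<Prod>i = 0..<r. E $$ (i, p i)))"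
    using degree_le_mult[OF degree_le_mconst[of "signof p"]] by fastforce
qed

section \<open>Quotients of the polynomial ring\<close>

lemma ring_of_type_algebra_simps [simp]:
  "carrier ring_of_type_algebra = UNIV"
  "x \<otimes>\<^bsub>ring_of_type_algebra\<^esub> y = x * y"
  "x \<oplus>\<^bsub>ring_of_type_algebra\<^esub> y = x + y"
  "\<zero>\<^bsub>ring_of_type_algebra\<^esub> = 0"
  "\<one>\<^bsub>ring_of_type_algebra\<^esub> = 1"
  by (simp_all add: ring_of_type_algebra_def)

lemma set_add_poly_ring: "A <+>\<^bsub>poly_ring\<^esub> B = {a + b | a b. a \<in> A \<and> b \<in> B}"
  by (auto simp: set_add_def')

locale mpoly_ideal =
  fixes J :: "('n, 'a::field) mpoly set"
  assumes ideal: "ideal J poly_ring"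
begin

sublocale ideal J poly_ring by (rule ideal)

abbreviation proj :: "('n, 'a) mpoly \<Rightarrow> ('n, 'a) mpoly set" where
  "proj f \<equiv> J +>\<^bsub>poly_ring\<^esub> f"

lemma zero_mem: "0 \<in> J"
  using additive_subgroup.zero_closed[OF is_additive_subgroup] by simp

lemma add_mem: "x \<in> J \<Longrightarrow> y \<in> J \<Longrightarrow> x + y \<in> J"
  using additive_subgroup.a_closed[OF is_additive_subgroup] by simp

lemma mult_mem: "x \<in> J \<Longrightarrow> y * x \<in> J" using I_l_closed by simp

lemma uminus_mem: "x \<in> J \<Longrightarrow> - x \<in> J" using mult_mem[of x "-1"] by simp

lemma diff_mem: "x \<in> J \<Longrightarrow> y \<in> J \<Longrightarrow> x - y \<in> J"
  using add_mem[of x "- y"] uminus_mem by simp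

lemma sum_mem: "(\<And>x. x \<in> A \<Longrightarrow> f x \<in> J) \<Longrightarrow> (\<Sum>x\<in>A. f x) \<in> J"
  by (induction A rule: infinite_finite_induct) (auto simp: zero_mem add_mem)

lemma proj_def: "proj f = {j + f | j. j \<in> J}"
  by (auto simp: a_r_coset_def')

lemma proj_eq_iff: "proj f = proj g \<longleftrightarrow> f - g \<in> J"
proof
  assume "proj f = proj g"
  then have "f \<in> proj g" using zero_mem by (auto simp: proj_def)
  then show "f - g \<in> J" by (auto simp: proj_def)
next
  assume *: "f - g \<in> J"
  show "proj f = proj g"
  proof (intro equalityI subsetI)
    fix x assume "x \<in> proj f"
    then obtain j where "j \<in> J" "x = j + f" by (auto simp: proj_def)
    then have "x = (j + (f - g)) + g" "j + (f - g) \<in> J" using * by (auto intro: add_mem)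
    then show "x \<in> proj g" unfolding proj_def by blast
  next
    fix x assume "x \<in> proj g"
    then obtain j where "j \<in> J" "x = j + g" by (auto simp: proj_def)
    then have "x = (j - (f - g)) + f" "j - (f - g) \<in> J" using * by (auto intro: diff_mem)
    then show "x \<in> proj f" unfolding proj_def by blast
  qed
qed

sublocale Q: Ring.ring "quot_alg J" by (rule quotient_is_ring)

lemma carrier_quot: "carrier (quot_alg J) = range proj"
  by (auto simp: FactRing_def A_RCOSETS_def')

lemma proj_hom: "proj \<in> Ring.ring_hom poly_ring (quot_alg J)"
  by (rule rcos_ring_hom)

lemma quot_simps:
  "proj f \<otimes>\<^bsub>quot_alg J\<^esub> proj g = proj (f * g)"
  "proj f \<oplus>\<^bsub>quot_alg J\<^esub> proj g = proj (f + g)"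
  "\<zero>\<^bsub>quot_alg J\<^esub> = proj 0" "\<one>\<^bsub>quot_alg J\<^esub> = proj 1"
  using ring_hom_mult[OF proj_hom, of f g] ring_hom_add[OF proj_hom, of f g]
    ring_hom_one[OF proj_hom] proj_eq_iff
  by (auto simp: FactRing_def proj_def)

text \<open>Turns linear combinations in the quotient into cosets of polynomial sums, so that later
  arguments can work with polynomials modulo \<open>J\<close>.\<close>

lemma combine_quot_const:
  "length cs = length fs \<Longrightarrow> Q.combine (map (quot_const J) cs) (map proj fs) =
     proj (\<Sum>k<length fs. mconst (cs ! k) * fs ! k)"
proof (induction cs fs rule: list_induct2)
  case (Cons c cs f fs)
  then show ?case
    by (simp add: quot_const_def quot_simps sum.lessThan_Suc_shift del: sum.lessThan_Suc)
qed (simp add: quot_simps)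

text \<open>Used in contrapositive form: positive dimension forces the ideal to be proper. Here the
  scalars collapse to zero, so the value is read off from the inductive definition of
  dimension.\<close>

lemma quot_dim_improper:
  assumes "1 \<in> J"
  shows "quot_dim J = 0"
proof -
  have "proj f = proj 0" for f
    using mult_mem[OF assms, of f] by (simp add: proj_eq_iff)
  then have c: "carrier (quot_alg J) = {\<zero>\<^bsub>quot_alg J\<^esub>}"
    by (auto simp: carrier_quot quot_simps)
  \<comment> \<open>An extension step needs a vector outside the space built so far, but the only
    vector is zero.\<close>
  have dim0: "n = 0 \<and> E = {\<zero>\<^bsub>quot_alg J\<^esub>}" if "Q.dimension n K E" for n K E
    using that by (induction rule: Q.dimension.induct) (auto simp: c)
  show ?thesis
    unfolding quot_dim_def Q.dim_def using c dim0 by (intro the_equality) auto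
qed

end

section \<open>Proper ideals: coordinates, bases and cardinalities\<close>

locale proper_mpoly_ideal = mpoly_ideal J
  for J :: "('n, 'a::field) mpoly set" +
  assumes proper: "1 \<notin> J"
begin

lemma mconst_mem_iff: "mconst c \<in> J \<longleftrightarrow> c = 0"
proof
  assume *: "mconst c \<in> J"
  show "c = 0"
  proof (rule ccontr)
    assume "c \<noteq> 0"
    then have "mconst (inverse c) * mconst c = (1 :: ('n, 'a) mpoly)"
      by (simp flip: mconst_mult)
    with mult_mem[OF *, of "mconst (inverse c)"] proper show False by simp
  qed
qed (simp add: zero_mem)

lemma inj_quot_const: "inj (quot_const J)"
  by (rule injI) (simp add: quot_const_def proj_eq_iff mconst_mem_iff flip: mconst.hom_minus)

text \<open>The image of a field under a ring homomorphism into a ring with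
  \<open>1 \<noteq> 0\<close>; properness of \<open>J\<close> gives the latter.\<close>

lemma subfield_quot_const: "subfield (range (quot_const J)) (quot_alg J)"
proof -
  let ?F = "ring_of_type_algebra :: 'a ring"
  interpret F: Ring.field ?F by (rule field_from_type_algebra)
  interpret h: ring_hom_ring ?F "quot_alg J" "quot_const J"
  proof (rule ring_hom_ringI2)
    show "quot_const J \<in> Ring.ring_hom ?F (quot_alg J)"
      by (rule ring_hom_memI)
        (auto simp: quot_const_def carrier_quot quot_simps mconst_mult mconst_add)
  qed (rule F.ring_axioms Q.ring_axioms)+
  have "\<one>\<^bsub>quot_alg J\<^esub> \<noteq> \<zero>\<^bsub>quot_alg J\<^esub>" by (simp add: quot_simps proj_eq_iff proper)
  from h.img_is_subfield(2)[OF F.carrier_is_subfield this] show ?thesis by simp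
qed

text \<open>Justifies the definite description in \<open>quot_coords\<close>; injectivity of
  \<open>quot_const\<close> transfers uniqueness from scalars in the quotient to field
  elements.\<close>

lemma quot_basis_unique_coords:
  assumes "quot_basis J bs" "v \<in> carrier (quot_alg J)"
  shows "\<exists>!cs. length cs = length bs \<and> Q.combine (map (quot_const J) cs) bs = v"
proof -
  let ?K = "range (quot_const J)"
  have ind: "Q.independent ?K bs" and "v \<in> Q.Span ?K bs"
    using assms by (auto simp: quot_basis_def)
  from Q.unique_decomposition[OF subfield_quot_const this]
  obtain Ks where Ks: "set Ks \<subseteq> ?K" "length Ks = length bs" "v = Q.combine Ks bs"
    and uniq: "\<And>Ks'. set Ks' \<subseteq> ?K \<Longrightarrow> length Ks' = length bs \<Longrightarrow> v = Q.combine Ks' bs \<Longrightarrow> Ks' = Ks"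
    by blast
  have "Ks \<in> lists ?K" using Ks(1) by (simp add: in_lists_conv_set subset_iff)
  then obtain cs where cs: "Ks = map (quot_const J) cs" by (auto simp: lists_image)
  show ?thesis
  proof (rule ex1I[of _ cs])
    show "length cs = length bs \<and> Q.combine (map (quot_const J) cs) bs = v"
      using Ks cs by simp
  next
    fix cs' assume "length cs' = length bs \<and> Q.combine (map (quot_const J) cs') bs = v"
    then have "map (quot_const J) cs' = Ks" by (intro uniq) auto
    with cs show "cs' = cs" by (simp add: inj_quot_const)
  qed
qed

lemma quot_basis_coords:
  assumes "quot_basis J bs" "v \<in> carrier (quot_alg J)"
  shows "length (quot_coords J bs v) = length bs"
    "Q.combine (map (quot_const J) (quot_coords J bs v)) bs = v"
  using theI'[OF quot_basis_unique_coords[OF assms]] by (auto simp: quot_coords_def)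

lemma quot_basis_dim:
  assumes "quot_basis J bs"
  shows "quot_dim J = length bs"
  using Q.dimI[OF subfield_quot_const Q.dimensionI[OF subfield_quot_const]] assms
  unfolding quot_basis_def quot_dim_def over_def by blast

lemma quot_basis_card:
  assumes "quot_basis J bs" "finite (UNIV :: 'a set)"
  shows "card (carrier (quot_alg J)) = CARD('a) ^ length bs"
proof -
  let ?L = "{cs :: 'a list. set cs \<subseteq> UNIV \<and> length cs = length bs}"
  have carr: "set bs \<subseteq> carrier (quot_alg J)"
    using assms Q.independent_in_carrier by (auto simp: quot_basis_def)
  have "bij_betw (quot_coords J bs) (carrier (quot_alg J)) ?L"
  proof (rule bij_betw_byWitness[where f' = "\<lambda>cs. Q.combine (map (quot_const J) cs) bs"])
    have in_carr: "Q.combine (map (quot_const J) cs) bs \<in> carrier (quot_alg J)" for cs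
      using carr by (intro Q.combine_in_carrier) (auto simp: quot_const_def carrier_quot)
    then show "(\<lambda>cs. Q.combine (map (quot_const J) cs) bs) ` ?L \<subseteq> carrier (quot_alg J)" by auto
    show "\<forall>cs\<in>?L. quot_coords J bs (Q.combine (map (quot_const J) cs) bs) = cs"
      using quot_basis_unique_coords[OF assms(1) in_carr] quot_basis_coords[OF assms(1) in_carr] by blast
  qed (use quot_basis_coords[OF assms(1)] in auto)
  then show ?thesis
    using card_lists_length_eq[OF assms(2), of "length bs"] by (simp add: bij_betw_same_card)
qed

text \<open>Lifts the basis to polynomials \<open>b k\<close>: expansion and independence become
  congruences modulo \<open>J\<close>.\<close>

lemma quot_basis_reps:
  assumes "quot_basis J bs"
  obtains b where "\<And>k. k < length bs \<Longrightarrow> bs ! k = proj (b k)"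
    "\<And>f. f - (\<Sum>k<length bs. mconst (quot_coords J bs (proj f) ! k) * b k) \<in> J"
    "\<And>c k. (\<Sum>k<length bs. mconst (c k) * b k) \<in> J \<Longrightarrow> k < length bs \<Longrightarrow> c k = 0"
proof -
  have "set bs \<subseteq> range proj"
    using assms Q.independent_in_carrier carrier_quot by (auto simp: quot_basis_def)
  then have "bs \<in> lists (range proj)" by (simp add: in_lists_conv_set subset_iff)
  then obtain fs where fs: "bs = map proj fs" by (auto simp: lists_image)
  show thesis
  proof (rule that[of "\<lambda>k. fs ! k"])
    show "f - (\<Sum>k<length bs. mconst (quot_coords J bs (proj f) ! k) * fs ! k) \<in> J" for f
      using quot_basis_coords[OF assms, of "proj f"] combine_quot_const[of "quot_coords J bs (proj f)" fs]
      by (simp add: fs carrier_quot flip: proj_eq_iff)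
  next
    fix c k assume c: "(\<Sum>k<length bs. mconst (c k) * fs ! k) \<in> J" and k: "k < length bs"
    let ?cs = "map c [0..<length bs]" and ?z = "replicate (length bs) (0::'a)"
    have "Q.combine (map (quot_const J) ?cs) bs = proj 0"
      using combine_quot_const[of ?cs fs] c by (simp add: fs proj_eq_iff)
    moreover have "Q.combine (map (quot_const J) ?z) bs = proj 0"
      using combine_quot_const[of ?z fs] by (simp add: fs)
    ultimately have "?cs = ?z"
      using quot_basis_unique_coords[OF assms, of "proj 0"] by (auto simp: carrier_quot)
    then have "?cs ! k = ?z ! k" by simp
    with k show "c k = 0" by simp
  qed (simp add: fs)
qed

text \<open>No basis is given here: a finite carrier, listed completely, spans itself, so a basis
  exists.\<close>

lemma card_quot:
  assumes "finite (carrier (quot_alg J))" "finite (UNIV :: 'a set)"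
  shows "card (carrier (quot_alg J)) = CARD('a) ^ quot_dim J"
proof -
  let ?K = "range (quot_const J)"
  obtain us where us: "set us = carrier (quot_alg J)" using finite_list[OF assms(1)] by blast
  have K: "?K \<subseteq> carrier (quot_alg J)" by (auto simp: quot_const_def carrier_quot)
  have "Q.Span ?K us = carrier (quot_alg J)"
    using Q.Span_base_incl[OF subfield_quot_const, of us] Q.Span_in_carrier[OF K, of us] us by auto
  then have "Q.finite_dimension ?K (carrier (quot_alg J))"
    using Q.Span_finite_dimension[OF subfield_quot_const, of us] us by simp
  then obtain n where "Q.dimension n ?K (carrier (quot_alg J))" by blast
  from Q.exists_base[OF subfield_quot_const this] obtain bs where "quot_basis J bs"
    by (auto simp: quot_basis_def)
  then show ?thesis using quot_basis_card quot_basis_dim assms(2) by metis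
qed

end

section \<open>Linear forms and hyperplanes\<close>

definition linear_form :: "('n::finite \<Rightarrow> 'a::comm_ring_1) \<Rightarrow> ('n, 'a) mpoly" where
  "linear_form a = (\<Sum>j\<in>UNIV. mconst (a j) * mvar j)"

interpretation to_ac: comm_ring_hom to_ac
  by unfold_locales simp_all

lemma ac_eval_eq_mpoly_eval: "ac_eval f v = mpoly_eval to_ac (\<lambda>i. v $ i) f"
  by (simp add: ac_eval_def mpoly_eval_def)

interpretation ac_eval: comm_ring_hom "\<lambda>f. ac_eval f v" for v
  unfolding ac_eval_eq_mpoly_eval by (rule to_ac.comm_ring_hom_mpoly_eval)

lemma ideal_vanishing_ideal: "ideal (vanishing_ideal V) poly_ring"
proof -
  interpret P: cring "poly_ring :: ('a, 'b) mpoly ring" by (rule cring_from_type_algebra)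
  show ?thesis
  proof (rule idealI)
    show "subgroup (vanishing_ideal V) (add_monoid poly_ring)"
    proof (rule P.add.subgroupI)
      fix f assume f: "f \<in> vanishing_ideal V"
      have "\<ominus>\<^bsub>poly_ring\<^esub> f = - f"
        by (rule P.minus_equality) simp_all
      then show "\<ominus>\<^bsub>poly_ring\<^esub> f \<in> vanishing_ideal V"
        using f by (simp add: vanishing_ideal_def ac_eval.hom_uminus)
    qed (auto simp: vanishing_ideal_def ac_eval.hom_add intro: exI[of _ 0])
  qed (auto simp: vanishing_ideal_def ac_eval.hom_mult intro: P.ring_axioms)
qed

definition hyperplane :: "('n::finite \<Rightarrow> 'a::field) \<Rightarrow> ('a ^ 'n) set" where
  "hyperplane a = {v. (\<Sum>j\<in>UNIV. a j * v $ j) = 0}"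

lemma subspace_hyperplane: "vec.subspace (hyperplane a)"
  by (auto simp: vec.subspace_def hyperplane_def distrib_left sum.distrib mult.left_commute
      simp flip: sum_distrib_left)

text \<open>The unit vector in direction \<open>i\<close> lies off the hyperplane and together with
  it spans the whole space.\<close>

lemma dim_hyperplane:
  fixes a :: "'n::finite \<Rightarrow> 'a::field"
  assumes "a i \<noteq> 0"
  shows "vec.dim (hyperplane a) = CARD('n) - 1"
proof -
  let ?e = "axis i 1 :: 'a ^ 'n"
  have sum_e: "(\<Sum>j\<in>UNIV. a j * ?e $ j) = a i"
    by (simp add: axis_def if_distrib cong: if_cong)
  have span: "vec.span (hyperplane a) = hyperplane a"
    by (simp add: subspace_hyperplane vec.span_eq_iff)
  have "v \<in> vec.span (insert ?e (hyperplane a))" for v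
  proof -
    \<comment> \<open>Chosen so that subtracting \<open>t\<close> times the unit vector moves
      \<open>v\<close> into the hyperplane.\<close>
    define t where "t = (\<Sum>j\<in>UNIV. a j * v $ j) / a i"
    have "(\<Sum>j\<in>UNIV. a j * (v - t *s ?e) $ j) = (\<Sum>j\<in>UNIV. a j * v $ j) - t * (\<Sum>j\<in>UNIV. a j * ?e $ j)"
      by (simp add: right_diff_distrib sum_subtractf sum_distrib_left mult_ac)
    also have "\<dots> = 0" using assms by (simp add: sum_e t_def)
    finally have "v - t *s ?e \<in> hyperplane a" by (simp add: hyperplane_def)
    then show ?thesis unfolding vec.span_insert span by blast
  qed
  then have "vec.span (insert ?e (hyperplane a)) = UNIV" by auto
  then have "vec.dim (insert ?e (hyperplane a)) = CARD('n)"
    by (metis vec.dim_span vec_dim_card)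
  moreover have "?e \<notin> vec.span (hyperplane a)"
    unfolding span using assms sum_e by (simp add: hyperplane_def)
  ultimately show ?thesis by (simp add: vec.dim_insert)
qed

text \<open>The form vanishes at the rational points of the hyperplane; being linear, it vanishes on
  their span over the algebraic closure.\<close>

lemma linear_form_mem_vanishing_ideal: "linear_form a \<in> vanishing_ideal (hyperplane a)"
proof -
  have ev: "ac_eval (linear_form a) v = (\<Sum>j\<in>UNIV. to_ac (a j) * v $ j)" for v
    unfolding linear_form_def ac_eval.hom_sum ac_eval.hom_mult
    by (simp add: ac_eval_eq_mpoly_eval to_ac.mpoly_eval_mconst to_ac.mpoly_eval_mvar)
  have "ac_eval (linear_form a) v = 0" if "v \<in> ac_points (hyperplane a)" for v
    using that unfolding ac_points_def
  proof (induction rule: vec.span_induct_alt)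
    case (step c x y)
    then obtain w where w: "x = (\<chi> i. to_ac (w $ i))" "(\<Sum>j\<in>UNIV. a j * w $ j) = 0"
      by (auto simp: hyperplane_def)
    have "(\<Sum>j\<in>UNIV. to_ac (a j) * x $ j) = to_ac (\<Sum>j\<in>UNIV. a j * w $ j)"
      by (simp add: w(1) to_ac_sum)
    then have "(\<Sum>j\<in>UNIV. to_ac (a j) * x $ j) = 0" by (simp add: w(2))
    then have "c * (\<Sum>j\<in>UNIV. to_ac (a j) * x $ j) = 0" by simp
    with step show ?case
      by (simp add: ev distrib_left sum.distrib sum_distrib_left mult_ac)
  qed (simp add: ev)
  then show ?thesis by (simp add: vanishing_ideal_def)
qed

section \<open>The multiplication matrix\<close>

text \<open>The counting form of the fact that a submatrix has no larger rank: extend the vector by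
  zero outside the columns \<open>T\<close>, apply \<open>A\<close>, and read off the rows
  \<open>S\<close>.\<close>

lemma card_image_submatrix_le:
  fixes A :: "'a::{comm_ring_1,finite} Matrix.mat"
  assumes A: "A \<in> carrier_mat N N" and S: "S \<subseteq> {..<N}" "card S = r"
    and T: "T \<subseteq> {..<N}" "card T = r"
  shows "card ((\<lambda>v. submatrix A S T *\<^sub>v v) ` carrier_vec r) \<le> card ((\<lambda>v. A *\<^sub>v v) ` carrier_vec N)"
proof -
  have ST: "{i. i < N \<and> i \<in> S} = S" "{i. i < N \<and> i \<in> T} = T" using S T by auto
  have dims: "dim_row (submatrix A S T) = r" "dim_col (submatrix A S T) = r"
    using A S T by (auto simp: dim_submatrix ST)
  have pick: "pick S i < N" "pick T i < N" if "i < r" for i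
    using pick_in_set_le[of i S] pick_in_set_le[of i T] that S T by auto
  have "(\<lambda>v. submatrix A S T *\<^sub>v v) ` carrier_vec r \<subseteq>
      (\<lambda>w. Matrix.vec r (\<lambda>i. vec_index w (pick S i))) ` (\<lambda>v. A *\<^sub>v v) ` carrier_vec N"
  proof (rule image_subsetI)
    fix v :: "'a Matrix.vec" assume v: "v \<in> carrier_vec r"
    define v' where "v' = Matrix.vec N (\<lambda>j. \<Sum>k<r. if pick T k = j then vec_index v k else 0)"
    have "submatrix A S T *\<^sub>v v = Matrix.vec r (\<lambda>i. vec_index (A *\<^sub>v v') (pick S i))"
    proof (rule eq_vecI)
      fix i assume "i < dim_vec (Matrix.vec r (\<lambda>i. vec_index (A *\<^sub>v v') (pick S i)))"
      then have i: "i < r" by simp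
      have "vec_index (A *\<^sub>v v') (pick S i) =
          (\<Sum>j<N. A $$ (pick S i, j) * (\<Sum>k<r. if pick T k = j then vec_index v k else 0))"
        using A pick[OF i] by (simp add: scalar_prod_def v'_def atLeast0LessThan)
      also have "\<dots> = (\<Sum>j<N. \<Sum>k<r. if pick T k = j then A $$ (pick S i, j) * vec_index v k else 0)"
        by (simp add: sum_distrib_left if_distrib cong: if_cong)
      also have "\<dots> = (\<Sum>k<r. \<Sum>j<N. if pick T k = j then A $$ (pick S i, j) * vec_index v k else 0)"
        by (rule sum.swap)
      also have "\<dots> = (\<Sum>k<r. A $$ (pick S i, pick T k) * vec_index v k)"
        using pick by (intro sum.cong) auto
      also have "\<dots> = vec_index (submatrix A S T *\<^sub>v v) i"
        using i v A S T dims by (simp add: scalar_prod_def atLeast0LessThan submatrix_index ST)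
      finally show "vec_index (submatrix A S T *\<^sub>v v) i =
          vec_index (Matrix.vec r (\<lambda>i. vec_index (A *\<^sub>v v') (pick S i))) i"
        using i by simp
    qed (simp add: dims)
    then show "submatrix A S T *\<^sub>v v \<in>
        (\<lambda>w. Matrix.vec r (\<lambda>i. vec_index w (pick S i))) ` (\<lambda>v. A *\<^sub>v v) ` carrier_vec N"
      by (auto simp: v'_def intro!: imageI)
  qed
  then show ?thesis
    by (meson card_carrier_vec(2) card_image_le card_mono finite_imageI le_trans)
qed

text \<open>The value \<open>U(a)\<close> of \<open>U(h)\<close> at a point, with entries in the
  field so that its image can be counted.\<close>

definition mult_matrix_at ::
    "('n::finite, 'a::field) mpoly set \<Rightarrow> ('n, 'a) mpoly set list \<Rightarrow> ('n \<Rightarrow> 'a) \<Rightarrow> 'a Matrix.mat" where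
  "mult_matrix_at I bs a = Matrix.mat (length bs) (length bs) (\<lambda>(i, k).
     \<Sum>j\<in>UNIV. quot_coords I bs ((I +>\<^bsub>poly_ring\<^esub> mvar j) \<otimes>\<^bsub>quot_alg I\<^esub> (bs ! k)) ! i * a j)"

text \<open>The counting form of \<open>dim (F[x]/J) + rank U(a) \<le> N\<close>. The image of
  \<open>U(a)\<close> consists of multiples of the linear form, which die modulo \<open>J\<close>;
  adding them to chosen representatives of the cosets of \<open>J\<close> gives pairwise distinct
  elements of \<open>R\<close>.\<close>

lemma card_image_mult_matrix_at:
  fixes I J :: "('n::finite, 'a::{field,finite}) mpoly set"
  assumes I: "ideal I poly_ring" and basis: "quot_basis I bs"
    and J: "ideal J poly_ring" "1 \<notin> J" and IJ: "I \<subseteq> J" and lin: "linear_form a \<in> J"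
  shows "CARD('a) ^ quot_dim J *
    card ((\<lambda>v. mult_matrix_at I bs a *\<^sub>v v) ` carrier_vec (length bs)) \<le> CARD('a) ^ length bs"
proof -
  interpret I: proper_mpoly_ideal I
    using I J IJ by (intro proper_mpoly_ideal.intro mpoly_ideal.intro proper_mpoly_ideal_axioms.intro) auto
  interpret J: proper_mpoly_ideal J
    using J by (intro proper_mpoly_ideal.intro mpoly_ideal.intro proper_mpoly_ideal_axioms.intro) auto
  let ?N = "length bs" and ?l = "linear_form a" and ?U = "mult_matrix_at I bs a"
  obtain b where b: "\<And>k. k < ?N \<Longrightarrow> bs ! k = I.proj (b k)"
    and coords: "\<And>f. f - (\<Sum>k<?N. mconst (quot_coords I bs (I.proj f) ! k) * b k) \<in> I"
    and indep: "\<And>c k. (\<Sum>k<?N. mconst (c k) * b k) \<in> I \<Longrightarrow> k < ?N \<Longrightarrow> c k = 0"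
    using I.quot_basis_reps[OF basis] by blast
  define \<phi> where "\<phi> f k = quot_coords I bs (I.proj f) ! k" for f k
  note coords = coords[folded \<phi>_def]
  \<comment> \<open>Any combination of the \<open>b k\<close> congruent to \<open>f\<close> modulo
    \<open>I\<close> already has the coordinates of \<open>f\<close>.\<close>
  have \<phi>I: "\<phi> f k = c k" if *: "f - (\<Sum>k<?N. mconst (c k) * b k) \<in> I" and k: "k < ?N" for f c k
  proof -
    have "(\<Sum>k<?N. mconst (\<phi> f k - c k) * b k) =
        (f - (\<Sum>k<?N. mconst (c k) * b k)) - (f - (\<Sum>k<?N. mconst (\<phi> f k) * b k))"
      by (simp add: mconst.hom_minus left_diff_distrib sum_subtractf)
    then have "(\<Sum>k<?N. mconst (\<phi> f k - c k) * b k) \<in> I"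
      using I.diff_mem[OF * coords[of f]] by simp
    from indep[OF this k] show ?thesis by simp
  qed
  have \<phi>_add: "\<phi> (f + g) k = \<phi> f k + \<phi> g k" if "k < ?N" for f g k
  proof (rule \<phi>I[OF _ that])
    show "f + g - (\<Sum>k<?N. mconst (\<phi> f k + \<phi> g k) * b k) \<in> I"
      using I.add_mem[OF coords[of f] coords[of g]]
      by (simp add: mconst_add distrib_right sum.distrib algebra_simps)
  qed
  have \<phi>_eqD: "f - g \<in> I" if "\<And>k. k < ?N \<Longrightarrow> \<phi> f k = \<phi> g k" for f g
    using I.diff_mem[OF coords[of f] coords[of g]] that by simp
  \<comment> \<open>\<open>U(a)\<close> represents multiplication by the linear form: the two sides
    differ by multiples of the expansion errors of \<open>mvar j * b k\<close>, which lie in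
    \<open>I\<close>.\<close>
  have U: "vec_index (?U *\<^sub>v v) i = \<phi> (?l * (\<Sum>k<?N. mconst (vec_index v k) * b k)) i"
    if v: "v \<in> carrier_vec ?N" and i: "i < ?N" for v i
  proof (rule sym, rule \<phi>I[OF _ i])
    let ?v = "vec_index v"
    have Uv: "vec_index (?U *\<^sub>v v) i = (\<Sum>k<?N. \<Sum>j\<in>UNIV. \<phi> (mvar j * b k) i * a j * ?v k)" if "i < ?N" for i
      using that v by (simp add: mult_matrix_at_def scalar_prod_def atLeast0LessThan sum_distrib_right
          b I.quot_simps \<phi>_def)
    have "?l * (\<Sum>k<?N. mconst (?v k) * b k) =
        (\<Sum>k<?N. \<Sum>j\<in>UNIV. mconst (a j * ?v k) * (mvar j * b k))"
      by (simp add: linear_form_def sum_product mconst_mult mult_ac) (rule sum.swap)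
    moreover have "(\<Sum>i<?N. mconst (vec_index (?U *\<^sub>v v) i) * b i) =
        (\<Sum>k<?N. \<Sum>j\<in>UNIV. mconst (a j * ?v k) * (\<Sum>i<?N. mconst (\<phi> (mvar j * b k) i) * b i))"
    proof -
      have "(\<Sum>i<?N. mconst (vec_index (?U *\<^sub>v v) i) * b i) =
        (\<Sum>i<?N. \<Sum>k<?N. \<Sum>j\<in>UNIV. mconst (a j * ?v k) * (mconst (\<phi> (mvar j * b k) i) * b i))"
        by (intro sum.cong refl)
          (simp add: Uv mconst.hom_sum mconst_mult sum_distrib_left sum_distrib_right mult_ac)
      also have "\<dots> = (\<Sum>k<?N. \<Sum>i<?N. \<Sum>j\<in>UNIV. mconst (a j * ?v k) * (mconst (\<phi> (mvar j * b k) i) * b i))"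
        by (rule sum.swap)
      also have "\<dots> = (\<Sum>k<?N. \<Sum>j\<in>UNIV. \<Sum>i<?N. mconst (a j * ?v k) * (mconst (\<phi> (mvar j * b k) i) * b i))"
        by (intro sum.cong refl) (rule sum.swap)
      finally show ?thesis by (simp add: sum_distrib_left)
    qed
    ultimately have "?l * (\<Sum>k<?N. mconst (?v k) * b k) - (\<Sum>i<?N. mconst (vec_index (?U *\<^sub>v v) i) * b i) =
      (\<Sum>k<?N. \<Sum>j\<in>UNIV. mconst (a j * ?v k) * (mvar j * b k - (\<Sum>i<?N. mconst (\<phi> (mvar j * b k) i) * b i)))"
      by (simp add: right_diff_distrib sum_subtractf)
    then show "?l * (\<Sum>k<?N. mconst (?v k) * b k) - (\<Sum>i<?N. mconst (vec_index (?U *\<^sub>v v) i) * b i) \<in> I"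
      by (auto intro!: I.sum_mem I.mult_mem coords)
  qed
  have dimU: "dim_row ?U = ?N" by (simp add: mult_matrix_at_def)
  let ?im = "(\<lambda>v. ?U *\<^sub>v v) ` carrier_vec ?N"
  \<comment> \<open>Since \<open>I \<subseteq> J\<close>, coordinates modulo \<open>I\<close>
    determine the coset modulo \<open>J\<close>, so there are finitely many cosets.\<close>
  have finJ: "finite (carrier (quot_alg J))"
  proof (rule finite_subset)
    show "carrier (quot_alg J) \<subseteq> (\<lambda>v. J.proj (\<Sum>k<?N. mconst (vec_index v k) * b k)) ` carrier_vec ?N"
    proof
      fix y assume "y \<in> carrier (quot_alg J)"
      then obtain f where "y = J.proj f" by (auto simp: J.carrier_quot)
      then have "y = J.proj (\<Sum>k<?N. mconst (vec_index (Matrix.vec ?N (\<phi> f)) k) * b k)"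
        using coords[of f] IJ by (auto simp: J.proj_eq_iff)
      then show "y \<in> (\<lambda>v. J.proj (\<Sum>k<?N. mconst (vec_index v k) * b k)) ` carrier_vec ?N"
        by (rule image_eqI) simp
    qed
  qed (intro finite_imageI card_carrier_vec)
  define rep where "rep y = (SOME f. J.proj f = y)" for y
  have rep: "J.proj (rep y) = y" if "y \<in> carrier (quot_alg J)" for y
    using that someI_ex[of "\<lambda>f. J.proj f = y"] by (auto simp: J.carrier_quot rep_def)
  \<comment> \<open>A coset of \<open>J\<close> and an image vector are sent to the coordinates of
    representative plus multiple of the linear form.\<close>
  define F where "F = (\<lambda>(y, w). Matrix.vec ?N (\<lambda>i. \<phi> (rep y) i + vec_index w i))"
  have "inj_on F (carrier (quot_alg J) \<times> ?im)"
  proof (rule inj_onI, clarify)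
    fix y y' v v'
    assume y: "y \<in> carrier (quot_alg J)" "y' \<in> carrier (quot_alg J)"
      and v: "v \<in> carrier_vec ?N" "v' \<in> carrier_vec ?N"
      and eq: "F (y, ?U *\<^sub>v v) = F (y', ?U *\<^sub>v v')"
    have eq': "\<phi> (rep y) i + vec_index (?U *\<^sub>v v) i = \<phi> (rep y') i + vec_index (?U *\<^sub>v v') i" if "i < ?N" for i
      using arg_cong[OF eq, of "\<lambda>w. vec_index w i"] that by (simp add: F_def)
    define g where "g v = ?l * (\<Sum>k<?N. mconst (vec_index v k) * b k)" for v
    have gJ: "g v \<in> J" for v
      using J.mult_mem[OF lin, of "\<Sum>k<?N. mconst (vec_index v k) * b k"]
      by (simp add: g_def mult.commute[of ?l])
    have "(rep y + g v) - (rep y' + g v') \<in> I"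
      using eq' v by (intro \<phi>_eqD) (simp add: \<phi>_add U g_def)
    then have "(rep y + g v) - (rep y' + g v') \<in> J" using IJ by auto
    from J.add_mem[OF this J.diff_mem[OF gJ[of v'] gJ[of v]]]
    have "(rep y + g v) - (rep y' + g v') + (g v' - g v) \<in> J" .
    then have "J.proj (rep y) = J.proj (rep y')" by (simp add: J.proj_eq_iff)
    then have "y = y'" using rep y by simp
    moreover have "?U *\<^sub>v v = ?U *\<^sub>v v'"
      using eq' \<open>y = y'\<close> by (intro eq_vecI) (auto simp: dimU)
    ultimately show "y = y' \<and> ?U *\<^sub>v v = ?U *\<^sub>v v'" by simp
  qed
  moreover have "F ` (carrier (quot_alg J) \<times> ?im) \<subseteq> carrier_vec ?N" by (auto simp: F_def)
  ultimately have "card (carrier (quot_alg J) \<times> ?im) \<le> card (carrier_vec ?N :: 'a Matrix.vec set)"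
    using card_carrier_vec(2) by (rule card_inj_on_le)
  then show ?thesis by (simp add: card_cartesian_product J.card_quot[OF finJ] card_carrier_vec)
qed

text \<open>For nonzero \<open>a\<close>, adding to \<open>I\<close> the ideal of
  \<open>hyperplane a\<close> gives an ideal that contains the linear form and has quotient
  dimension at least \<open>m\<close>; the preceding count then applies. The point
  \<open>a = 0\<close> defines no hyperplane and is treated separately.\<close>

lemma card_image_mult_matrix_at_le:
  fixes I :: "('n::finite, 'a::{field,finite}) mpoly set"
  assumes F: "hom_furstenberg I (CARD('n) - 1) m" and basis: "quot_basis I bs" and "m > 0"
  shows "m \<le> length bs"
    and "card ((\<lambda>v. mult_matrix_at I bs a *\<^sub>v v) ` carrier_vec (length bs)) \<le> CARD('a) ^ (length bs - m)"
    and "quot_dim I = length bs"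
proof -
  let ?N = "length bs"
  let ?im = "\<lambda>a. (\<lambda>v. mult_matrix_at I bs a *\<^sub>v v) ` carrier_vec ?N"
  interpret P: cring "poly_ring :: ('n, 'a) mpoly ring" by (rule cring_from_type_algebra)
  have I: "ideal I poly_ring" using F by (simp add: hom_furstenberg_def)
  interpret I: mpoly_ideal I by (rule mpoly_ideal.intro[OF I])
  have q: "CARD('a) > 1" using card_mono[of UNIV "{0, 1 :: 'a}"] by simp
  have bound: "CARD('a) ^ m * card (?im a) \<le> CARD('a) ^ ?N" and proper: "1 \<notin> I" if "a i \<noteq> 0" for a :: "'n \<Rightarrow> 'a" and i
  proof -
    let ?V = "vanishing_ideal (hyperplane a)"
    define J where "J = I <+>\<^bsub>poly_ring\<^esub> ?V"
    have dim: "m \<le> quot_dim J"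
      using F subspace_hyperplane dim_hyperplane[of a i, OF that] by (auto simp: hom_furstenberg_def J_def)
    have J: "ideal J poly_ring"
      unfolding J_def by (intro P.add_ideals I ideal_vanishing_ideal)
    interpret J: mpoly_ideal J by (rule mpoly_ideal.intro[OF J])
    interpret V: mpoly_ideal ?V by (rule mpoly_ideal.intro[OF ideal_vanishing_ideal])
    have "1 \<notin> J" using J.quot_dim_improper dim \<open>m > 0\<close> by auto
    moreover have IJ: "I \<subseteq> J"
      unfolding J_def set_add_poly_ring using V.zero_mem by force
    ultimately show "1 \<notin> I" by auto
    have "linear_form a \<in> J"
      unfolding J_def set_add_poly_ring using I.zero_mem linear_form_mem_vanishing_ideal[of a] by force
    with \<open>1 \<notin> J\<close> IJ have "CARD('a) ^ quot_dim J * card (?im a) \<le> CARD('a) ^ ?N"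
      using card_image_mult_matrix_at[OF I basis J] by blast
    moreover have "CARD('a) ^ m \<le> CARD('a) ^ quot_dim J"
      using dim q by (intro power_increasing) auto
    ultimately show "CARD('a) ^ m * card (?im a) \<le> CARD('a) ^ ?N" by (meson le_trans mult_le_mono1)
  qed
  show "quot_dim I = ?N"
    using proper[of "\<lambda>_. 1"] I basis
    by (intro proper_mpoly_ideal.quot_basis_dim proper_mpoly_ideal.intro mpoly_ideal.intro
        proper_mpoly_ideal_axioms.intro) auto
  have pos: "card (?im a) > 0" for a
  proof -
    have "0\<^sub>v ?N \<in> (carrier_vec ?N :: 'a Matrix.vec set)" by simp
    then have "?im a \<noteq> {}" by blast
    then show ?thesis by (simp add: card_gt_0_iff card_carrier_vec(2))
  qed
  \<comment> \<open>Images are nonempty, so the bound at one nonzero point, here the all-ones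
    vector, gives \<open>m \<le> N\<close>.\<close>
  have "CARD('a) ^ m * 1 \<le> CARD('a) ^ m * card (?im (\<lambda>_. 1))"
    using pos[of "\<lambda>_. 1"] by (intro mult_le_mono2) simp
  also have "\<dots> \<le> CARD('a) ^ ?N" by (rule bound) simp
  finally have "CARD('a) ^ m \<le> CARD('a) ^ ?N" by simp
  then show mN: "m \<le> ?N" using q by simp
  show "card (?im a) \<le> CARD('a) ^ (?N - m)"
  proof (cases "\<exists>i. a i \<noteq> 0")
    case True
    then have "CARD('a) ^ m * card (?im a) \<le> CARD('a) ^ m * CARD('a) ^ (?N - m)"
      using bound mN by (auto simp flip: power_add)
    then show ?thesis using q by simp
  next
    case False
    \<comment> \<open>At the origin the image is the zero vector alone, and
      \<open>1 \<le> q ^ (N - m)\<close>.\<close>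
    then have "mult_matrix_at I bs a = 0\<^sub>m ?N ?N" by (intro eq_matI) (auto simp: mult_matrix_at_def)
    then have "?im a \<subseteq> {0\<^sub>v ?N}" by auto
    then have "card (?im a) \<le> card {0\<^sub>v ?N :: 'a Matrix.vec}" by (intro card_mono) auto
    then show ?thesis using q by (simp add: Suc_le_eq le_trans)
  qed
qed

text \<open>The entries of \<open>U(h)\<close> are linear forms in \<open>h\<close>, so
  \<open>U(h + a) = U(a) + U(h)\<close>.\<close>

lemma mshift_submatrix_mult_matrix:
  fixes I :: "('n::finite, 'a::field) mpoly set"
  assumes S: "S \<subseteq> {..<length bs}" and T: "T \<subseteq> {..<length bs}"
  shows "map_mat (mshift a) (submatrix (mult_matrix I bs) S T) =
    map_mat mconst (submatrix (mult_matrix_at I bs a) S T) + submatrix (mult_matrix I bs) S T"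
proof -
  let ?N = "length bs"
  have ST: "{i. i < ?N \<and> i \<in> S} = S" "{i. i < ?N \<and> i \<in> T} = T" using S T by auto
  have entry: "mshift a (mult_matrix I bs $$ (i, k)) =
      mconst (mult_matrix_at I bs a $$ (i, k)) + mult_matrix I bs $$ (i, k)"
    if "i < ?N" "k < ?N" for i k
  proof -
    have "mshift a (mvar j) = mvar j + mconst (a j)" "mshift a (mconst x) = mconst x" for j x
      by (simp_all add: mshift_def mconst.mpoly_eval_mvar mconst.mpoly_eval_mconst)
    then show ?thesis
      using that by (simp add: mult_matrix_def mult_matrix_at_def mshift.hom_sum mshift.hom_mult
          mconst.hom_sum mconst_mult distrib_left sum.distrib add.commute)
  qed
  have dims: "dim_row (mult_matrix I bs) = ?N" "dim_col (mult_matrix I bs) = ?N"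
    "dim_row (mult_matrix_at I bs a) = ?N" "dim_col (mult_matrix_at I bs a) = ?N"
    by (simp_all add: mult_matrix_def mult_matrix_at_def)
  have pick: "pick S i < ?N" if "i < card S" for i using pick_in_set_le[OF that] S by auto
  have pick': "pick T i < ?N" if "i < card T" for i using pick_in_set_le[OF that] T by auto
  show ?thesis
    by (rule eq_matI)
      (auto simp: dim_submatrix submatrix_index entry pick pick' dims ST)
qed

section \<open>A nonzero minor and the final count\<close>

lemma J_ideal_nonzero_minor:
  assumes "J_ideal I bs l \<noteq> {0}" "1 \<le> l" "l \<le> int (length bs)"
  obtains S T where "S \<subseteq> {..<length bs}" "T \<subseteq> {..<length bs}"
    "card S = nat (int (length bs) - l + 1)" "card T = nat (int (length bs) - l + 1)"
    "Determinant.det (submatrix (mult_matrix I bs) S T) \<noteq> 0"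
proof -
  interpret P: cring "poly_ring :: ('a, 'b) mpoly ring" by (rule cring_from_type_algebra)
  let ?r = "nat (int (length bs) - l + 1)"
  \<comment> \<open>If all minors vanished, they would generate the zero ideal; the bounds on
    \<open>l\<close> exclude both conventional cases of \<open>J_ideal\<close>.\<close>
  have "\<not> minors (mult_matrix I bs) ?r \<subseteq> {0}"
  proof
    assume "minors (mult_matrix I bs) ?r \<subseteq> {0}"
    then have "Idl\<^bsub>poly_ring\<^esub> (minors (mult_matrix I bs) ?r) \<subseteq> {0}"
      using P.genideal_minimal[OF P.zeroideal] by simp
    moreover have "0 \<in> Idl\<^bsub>poly_ring\<^esub> (minors (mult_matrix I bs) ?r)"
      using additive_subgroup.zero_closed[OF ideal.axioms(1)[OF P.genideal_ideal]] by simp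
    ultimately show False using assms by (auto simp: J_ideal_def Let_def)
  qed
  then show thesis
    using that by (auto simp: minors_def mult_matrix_def)
qed

theorem theorem4p3:
  fixes I :: "('n::finite, 'a::{field,finite}) mpoly set"
    and bs :: "('n, 'a) mpoly set list"
    and q m :: nat and l :: int
  assumes "CARD('a) = q"
    and "CARD('n) \<ge> 2"
    and "hom_furstenberg I (CARD('n) - 1) m"
    and "quot_basis I bs"
    and "l \<le> int m"
    and "J_ideal I bs l \<noteq> {0}"
  shows "real (quot_dim I) \<ge> real q * real m * (1 - (real_of_int l - 1) / real m)"
proof (cases "m = 0")
  case False
  let ?N = "length bs" and ?U = "mult_matrix I bs"
  note mN = card_image_mult_matrix_at_le(1)[OF assms(3,4)]
    and im = card_image_mult_matrix_at_le(2)[OF assms(3,4)]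
  have mN: "m \<le> ?N" using mN False by simp
  \<comment> \<open>For \<open>l \<le> 0\<close> the minors would be larger than the matrix and
    \<open>J_ideal\<close> is zero by convention.\<close>
  have l: "1 \<le> l" using assms(6) by (auto simp: J_ideal_def Let_def split: if_splits)
  define r where "r = nat (int ?N - l + 1)"
  obtain S T where ST: "S \<subseteq> {..<?N}" "T \<subseteq> {..<?N}" "card S = r" "card T = r"
    and nz: "Determinant.det (submatrix ?U S T) \<noteq> 0"
    using J_ideal_nonzero_minor[OF assms(6) l] mN assms(5) unfolding r_def by auto
  have ST': "{i. i < ?N \<and> i \<in> S} = S" "{i. i < ?N \<and> i \<in> T} = T" using ST by auto
  have pick: "pick S i < ?N" "pick T i < ?N" if "i < r" for i
    using pick_in_set_le[of i S] pick_in_set_le[of i T] that ST by auto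
  have U: "?U \<in> carrier_mat ?N ?N" by (simp add: mult_matrix_def)
  have Ua: "mult_matrix_at I bs a \<in> carrier_mat ?N ?N" for a by (simp add: mult_matrix_at_def)
  have sub: "submatrix ?U S T \<in> carrier_mat r r" "submatrix (mult_matrix_at I bs a) S T \<in> carrier_mat r r" for a
    using U Ua[of a] ST by (auto intro!: carrier_matI simp: dim_submatrix ST')
  have entry: "submatrix ?U S T $$ (i, k) = ?U $$ (pick S i, pick T k)" if "i < r" "k < r" for i k
    using that U ST by (simp add: submatrix_index ST')
  have lin: "degree_le 1 (?U $$ (i, k))" "order_ge 1 (?U $$ (i, k))" if "i < ?N" "k < ?N" for i k
    using that degree_le_mult[OF degree_le_mconst degree_le_mvar]
    by (auto simp: mult_matrix_def intro!: degree_le_sum order_ge_sum order_ge_mult_left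
        order_ge_mvar[unfolded One_nat_def])
  have "degree_le r (Determinant.det (submatrix ?U S T))"
    by (rule degree_le_det[OF sub(1)]) (simp only: entry lin pick)
  from exists_low_order_shift[OF nz this] obtain a
    where a: "\<And>k. order_ge k (mshift a (Determinant.det (submatrix ?U S T))) \<Longrightarrow> CARD('a) * k \<le> r"
    by blast
  \<comment> \<open>This order bound holds at every point; \<open>a\<close> is the point of low
    order found above.\<close>
  have "order_ge (r - (?N - m)) (Determinant.det
      (map_mat mconst (submatrix (mult_matrix_at I bs a) S T) + submatrix ?U S T))"
  proof (rule order_ge_det_add_const[OF sub(2,1)])
    show "card ((\<lambda>v. submatrix (mult_matrix_at I bs a) S T *\<^sub>v v) ` carrier_vec r) \<le> CARD('a) ^ (?N - m)"
      using card_image_submatrix_le[OF Ua ST(1,3,2,4), of a] im[of a] False by simp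
    show "order_ge 1 (submatrix ?U S T $$ (i, j))" if "i < r" "j < r" for i j
      using that by (simp only: entry lin pick)
  qed
  then have "q * (r - (?N - m)) \<le> r"
    using a assms(1) by (simp add: ST mshift.hom_det flip: mshift_submatrix_mult_matrix)
  \<comment> \<open>With \<open>r = N - l + 1\<close>, the assumption \<open>l \<le> m\<close> keeps
    the natural-number subtraction from truncating.\<close>
  moreover have "int (r - (?N - m)) = int m - l + 1"
    using mN l assms(5) by (simp add: r_def)
  moreover have "int r \<le> int ?N" using l mN assms(5) by (simp add: r_def)
  ultimately have "int q * (int m - l + 1) \<le> int ?N"
    by (smt (verit) of_nat_mono of_nat_mult)
  then have "real_of_int (int q * (int m - l + 1)) \<le> real_of_int (int ?N)"
    by (simp only: of_int_le_iff)
  then have "real q * (real m - real_of_int l + 1) \<le> real ?N" by simp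
  moreover have "quot_dim I = ?N"
    using card_image_mult_matrix_at_le(3)[OF assms(3,4)] False by simp
  ultimately show ?thesis using False by (simp add: field_simps)
\<comment> \<open>The case \<open>m = 0\<close>: the factor \<open>real m\<close> makes the lower
  bound zero.\<close>
qed simp

end
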